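(* Fix $n\ge0$ and let $x\in\mathcal{R}_n$ be a vertex with source $\omega(x)$. Then the set $\varepsilon(x)$ of types of principal finite-index ideals of $\mathcal{O}_n$ whose homothety class is $x$ equals $$\varepsilon(x)=\{\omega(x)+k\vec e: k=0,1,2,\dots\}.$$
   Context: $K$ is a nonarchimedean local field of characteristic zero with ring of integers $\mathcal{O}_K$, uniformizer $p$, valuation $v_p$. $L$ is an unramified quadratic extension, a ramified quadratic extension (uniformizer $\pi$), or $K\times K$. $\mathcal{O}_L=\mathcal{O}_K[\Delta]$, $\mathcal{O}_n=\mathcal{O}_K[p^n\Delta]$. The type of a principal finite-index ideal $I=\alpha\mathcal{O}_n$ is $\varepsilon(I)=v_\pi(\alpha)$ in the field cases ($v_\pi$ the normalized valuation of $L$) and $(v_p(\alpha_1),v_p(\alpha_2))$ if $L=K\times K$, $\alpha=(\alpha_1,\alpha_2)$. The translation vector is $\vec e=1$ (unramified), $\vec e=2$ (ramified), $\vec e=(1,1)$ (split). Vertices of the Bruhat–Tits tree are $K^*$-homothety classes of $\mathcal{O}_K$-lattices in $L$. For two such ideals, $I\le J$ means $I,J$ are homothetic by $K^*$ and $\varepsilon(J)-\varepsilon(I)$ has nonnegative entries; the source $\omega(x)$ of a vertex $x\in\mathcal{R}_n$ is the type of the minimum, for $\le$, among the principal finite-index ideals of $\mathcal{O}_n$ with class $x$. The basin $\mathcal{P}$ is $\{[\mathcal{O}_L]\}$ (unramified), the edge $\{[\mathcal{O}_L],[\pi\mathcal{O}_L]\}$ (ramified), or the apartment $\{[\mathcal{O}_K\times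 p^m\mathcal{O}_K]:m\in\mathbb{Z}\}$ (split); $\mathcal{P}_0=\mathcal{P}$, $\mathcal{P}_k=\{v:d(v,\mathcal{P}_{k-1})\le1\}$, $\mathcal{R}_0=\mathcal{P}$, $\mathcal{R}_k=\mathcal{P}_k\setminus\mathcal{P}_{k-1}$. *)

theory Defs
  imports
    Complex_Main
    "HOL-Computational_Algebra.Polynomial"
    "HOL-Library.Product_Order"
    "HOL-Library.Extended_Nat"
begin

instantiation prod :: (comm_ring_1, comm_ring_1) comm_ring_1
begin

definition one_prod :: "'a \<times> 'b" where
  "one_prod = (1, 1)"

definition times_prod :: "'a \<times> 'b \<Rightarrow> 'a \<times> 'b \<Rightarrow> 'a \<times> 'b" where
  "times_prod x y = (fst x * fst y, snd x * snd y)"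

instance
  by standard (auto simp: one_prod_def times_prod_def zero_prod_def plus_prod_def algebra_simps)

end

text \<open>Valuations are integer valued and constrained on nonzero elements only; the value at \<open>0\<close>
  is arbitrary, and every use below treats \<open>0\<close> separately.\<close>

locale normalized_valuation =
  fixes v :: "'a::field \<Rightarrow> int"
  assumes mult: "x \<noteq> 0 \<Longrightarrow> y \<noteq> 0 \<Longrightarrow> v (x * y) = v x + v y"
    and add: "x \<noteq> 0 \<Longrightarrow> y \<noteq> 0 \<Longrightarrow> x + y \<noteq> 0 \<Longrightarrow> min (v x) (v y) \<le> v (x + y)"
    and normalized: "\<exists>x. x \<noteq> 0 \<and> v x = 1"

definition val_ge :: "('a::field \<Rightarrow> int) \<Rightarrow> int \<Rightarrow> 'a set" where
  "val_ge v m = {x. x = 0 \<or> m \<le> v x}"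

abbreviation valuation_ring :: "('a::field \<Rightarrow> int) \<Rightarrow> 'a set" where
  "valuation_ring v \<equiv> val_ge v 0"

locale local_field = normalized_valuation v for v :: "'a::field \<Rightarrow> int" +
  assumes finite_residue_field: "finite ((\<lambda>x. (+) x ` val_ge v 1) ` valuation_ring v)"
    and complete:
      "(\<forall>m. \<exists>N. \<forall>i\<ge>N. \<forall>j\<ge>N. X i - X j \<in> val_ge v m) \<Longrightarrow>
       \<exists>x. \<forall>m. \<exists>N. \<forall>i\<ge>N. (X :: nat \<Rightarrow> 'a) i - x \<in> val_ge v m"

text \<open>\<open>w\<close> is the normalized valuation of \<open>L\<close> (unique, as \<open>K\<close> is complete), so it restricts to \<open>e\<close> times
  the valuation of \<open>K\<close> with \<open>e\<close> the ramification index.\<close>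

locale quadratic_extension = normalized_valuation w for w :: "'l::field \<Rightarrow> int" +
  fixes v :: "'k::field \<Rightarrow> int" and emb :: "'k \<Rightarrow> 'l" and e :: int
  assumes emb_one: "emb 1 = 1"
    and emb_add: "emb (a + b) = emb a + emb b"
    and emb_mult: "emb (a * b) = emb a * emb b"
    and degree_two: "vector_space.dim (\<lambda>a x. emb a * x) (UNIV :: 'l set) = 2"
    and ramification_index: "a \<noteq> 0 \<Longrightarrow> w (emb a) = e * v a"

definition unramified_quadratic ::
    "('k::field \<Rightarrow> int) \<Rightarrow> ('k \<Rightarrow> 'l::field) \<Rightarrow> ('l \<Rightarrow> int) \<Rightarrow> bool" where
  "unramified_quadratic v emb w \<longleftrightarrow> quadratic_extension w v emb 1"

definition ramified_quadratic ::
    "('k::field \<Rightarrow> int) \<Rightarrow> ('k \<Rightarrow> 'l::field) \<Rightarrow> ('l \<Rightarrow> int) \<Rightarrow> bool" where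
  "ramified_quadratic v emb w \<longleftrightarrow> quadratic_extension w v emb 2"

definition diag :: "'k \<Rightarrow> 'k \<times> 'k" where
  "diag a = (a, a)"

definition split_val :: "('k \<Rightarrow> int) \<Rightarrow> 'k \<times> 'k \<Rightarrow> int \<times> int" where
  "split_val v \<alpha> = (v (fst \<alpha>), v (snd \<alpha>))"

definition adjoin :: "('k::field \<Rightarrow> int) \<Rightarrow> ('k \<Rightarrow> 'l::comm_ring_1) \<Rightarrow> 'l \<Rightarrow> 'l set" where
  "adjoin v emb a = {poly (map_poly emb f) a |f. \<forall>i. coeff f i \<in> valuation_ring v}"

definition order_ring ::
    "('k::field \<Rightarrow> int) \<Rightarrow> 'k \<Rightarrow> ('k \<Rightarrow> 'l::comm_ring_1) \<Rightarrow> 'l \<Rightarrow> nat \<Rightarrow> 'l set" where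
  "order_ring v p emb \<Delta> n = adjoin v emb (emb p ^ n * \<Delta>)"

definition is_lattice :: "('k::field \<Rightarrow> int) \<Rightarrow> ('k \<Rightarrow> 'l::comm_ring_1) \<Rightarrow> 'l set \<Rightarrow> bool" where
  "is_lattice v emb \<Lambda> \<longleftrightarrow>
     (\<exists>B. finite B \<and>
          \<Lambda> = {\<Sum>b\<in>B. emb (c b) * b |c. \<forall>b\<in>B. c b \<in> valuation_ring v}) \<and>
     module.span (\<lambda>a x. emb a * x) \<Lambda> = UNIV"

definition homothety_class :: "('k::field \<Rightarrow> 'l::comm_ring_1) \<Rightarrow> 'l set \<Rightarrow> 'l set set" where
  "homothety_class emb \<Lambda> = {(*) (emb c) ` \<Lambda> |c. c \<noteq> 0}"

definition vertices :: "('k::field \<Rightarrow> int) \<Rightarrow> ('k \<Rightarrow> 'l::comm_ring_1) \<Rightarrow> 'l set set set" where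
  "vertices v emb = homothety_class emb ` {\<Lambda>. is_lattice v emb \<Lambda>}"

definition adjacency ::
    "('k::field \<Rightarrow> int) \<Rightarrow> 'k \<Rightarrow> ('k \<Rightarrow> 'l::comm_ring_1) \<Rightarrow> ('l set set \<times> 'l set set) set" where
  "adjacency v p emb =
     {(homothety_class emb \<Lambda>, homothety_class emb M) |\<Lambda> M.
        is_lattice v emb \<Lambda> \<and> is_lattice v emb M \<and> (*) (emb p) ` \<Lambda> \<subset> M \<and> M \<subset> \<Lambda>}"

definition tree_dist ::
    "('k::field \<Rightarrow> int) \<Rightarrow> 'k \<Rightarrow> ('k \<Rightarrow> 'l::comm_ring_1) \<Rightarrow> 'l set set \<Rightarrow> 'l set set \<Rightarrow> enat" where
  "tree_dist v p emb x y = (INF k\<in>{k. (x, y) \<in> adjacency v p emb ^^ k}. enat k)"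

definition tree_setdist ::
    "('k::field \<Rightarrow> int) \<Rightarrow> 'k \<Rightarrow> ('k \<Rightarrow> 'l::comm_ring_1) \<Rightarrow> 'l set set \<Rightarrow> 'l set set set \<Rightarrow> enat" where
  "tree_setdist v p emb x S = (INF s\<in>S. tree_dist v p emb x s)"

primrec basin_nbhd ::
    "('k::field \<Rightarrow> int) \<Rightarrow> 'k \<Rightarrow> ('k \<Rightarrow> 'l::comm_ring_1) \<Rightarrow> 'l set set set \<Rightarrow> nat \<Rightarrow> 'l set set set" where
  "basin_nbhd v p emb P 0 = P"
| "basin_nbhd v p emb P (Suc k) =
     {x \<in> vertices v emb. tree_setdist v p emb x (basin_nbhd v p emb P k) \<le> 1}"

primrec basin_shell ::
    "('k::field \<Rightarrow> int) \<Rightarrow> 'k \<Rightarrow> ('k \<Rightarrow> 'l::comm_ring_1) \<Rightarrow> 'l set set set \<Rightarrow> nat \<Rightarrow> 'l set set set" where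
  "basin_shell v p emb P 0 = P"
| "basin_shell v p emb P (Suc k) = basin_nbhd v p emb P (Suc k) - basin_nbhd v p emb P k"

definition unramified_basin :: "('k::field \<Rightarrow> 'l::field) \<Rightarrow> ('l \<Rightarrow> int) \<Rightarrow> 'l set set set" where
  "unramified_basin emb w = {homothety_class emb (valuation_ring w)}"

definition ramified_basin :: "('k::field \<Rightarrow> 'l::field) \<Rightarrow> ('l \<Rightarrow> int) \<Rightarrow> 'l \<Rightarrow> 'l set set set" where
  "ramified_basin emb w \<pi> =
     {homothety_class emb (valuation_ring w), homothety_class emb ((*) \<pi> ` valuation_ring w)}"

definition split_basin :: "('k::field \<Rightarrow> int) \<Rightarrow> 'k \<Rightarrow> ('k \<times> 'k) set set set" where
  "split_basin v p =
     range (\<lambda>m::int. homothety_class diag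
       (valuation_ring v \<times> (*) (p powi m) ` valuation_ring v))"

definition finite_index_principal_ideals :: "'l::comm_ring_1 set \<Rightarrow> 'l set set" where
  "finite_index_principal_ideals R =
     {I. (\<exists>\<alpha>\<in>R. I = (*) \<alpha> ` R) \<and> finite ((\<lambda>y. (+) y ` I) ` R)}"

text \<open>Generators of a finite-index ideal differ by units of \<open>R\<close>, so the type is well defined; the
  valuation \<open>val\<close> takes values in \<open>int\<close> for a field \<open>L\<close> and in \<open>int \<times> int\<close>, ordered and added
  componentwise, for \<open>L = K \<times> K\<close>.\<close>

definition ideal_type :: "('l::comm_ring_1 \<Rightarrow> 't) \<Rightarrow> 'l set \<Rightarrow> 'l set \<Rightarrow> 't" where
  "ideal_type val R I = (THE t. \<exists>\<alpha>. I = (*) \<alpha> ` R \<and> t = val \<alpha>)"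

definition ideal_le ::
    "('k::field \<Rightarrow> 'l::comm_ring_1) \<Rightarrow> ('l \<Rightarrow> 't::{minus,zero,ord}) \<Rightarrow>
     'l set \<Rightarrow> 'l set \<Rightarrow> 'l set \<Rightarrow> bool" where
  "ideal_le emb val R I J \<longleftrightarrow>
     (\<exists>c. c \<noteq> 0 \<and> J = (*) (emb c) ` I) \<and> 0 \<le> ideal_type val R J - ideal_type val R I"

definition ideals_of_class ::
    "('k::field \<Rightarrow> 'l::comm_ring_1) \<Rightarrow> 'l set \<Rightarrow> 'l set set \<Rightarrow> 'l set set" where
  "ideals_of_class emb R x = {I \<in> finite_index_principal_ideals R. homothety_class emb I = x}"

definition types_of ::
    "('k::field \<Rightarrow> 'l::comm_ring_1) \<Rightarrow> ('l \<Rightarrow> 't) \<Rightarrow> 'l set \<Rightarrow> 'l set set \<Rightarrow> 't set" where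
  "types_of emb val R x = ideal_type val R ` ideals_of_class emb R x"

definition source ::
    "('k::field \<Rightarrow> 'l::comm_ring_1) \<Rightarrow> ('l \<Rightarrow> 't::{minus,zero,ord}) \<Rightarrow>
     'l set \<Rightarrow> 'l set set \<Rightarrow> 't" where
  "source emb val R x = ideal_type val R
     (THE I. I \<in> ideals_of_class emb R x \<and> (\<forall>J\<in>ideals_of_class emb R x. ideal_le emb val R I J))"

end

theory Submission
  imports Defs
begin

text \<open>
  Scaling a lattice \<open>\<Lambda>\<close> by the inverse of an element of minimal valuation gives a lattice between
  \<open>O\<^sub>K\<close> and \<open>O\<^sub>L = O\<^sub>K + O\<^sub>K \<Delta>\<close>, and such a lattice is one of the orders \<open>O\<^sub>m\<close>; hence every vertex is the class of
  some \<open>\<alpha> O\<^sub>m\<close> with \<open>\<alpha>\<close> a unit of \<open>L\<close>. The inclusions \<open>p O\<^sub>m \<subset> O\<^sub>m\<^sub>+\<^sub>1 \<subset> O\<^sub>m\<close> put this class at distance at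
  most \<open>m\<close> from the basin, and since the level \<open>m\<close> rises by at most one along an edge, the distance
  is exactly \<open>m\<close>. For \<open>x = [\<alpha> O\<^sub>n]\<close> the ideals of class \<open>x\<close> are the \<open>c \<alpha> O\<^sub>n\<close> with \<open>c \<alpha> \<in> O\<^sub>n\<close>, a lower bound on the
  valuation of \<open>c\<close>, and multiplying \<open>c\<close> by \<open>p\<close> adds the translation vector to the type.
\<close>

context normalized_valuation
begin

lemma v_one [simp]: "v 1 = 0"
  using mult[of 1 1] by simp

lemma v_minus [simp]: "v (- x) = v x"
proof (cases "x = 0")
  case False
  have "v (-1) = 0"
    using mult[of "-1" "-1"] by simp
  then show ?thesis
    using mult[of "-1" x] False by simp
qed simp

lemma v_inverse: "x \<noteq> 0 \<Longrightarrow> v (inverse x) = - v x"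
  using mult[of x "inverse x"] by simp

lemma v_divide: "x \<noteq> 0 \<Longrightarrow> y \<noteq> 0 \<Longrightarrow> v (x / y) = v x - v y"
  using mult[of x "inverse y"] v_inverse[of y] by (simp add: divide_inverse)

lemma v_power: "x \<noteq> 0 \<Longrightarrow> v (x ^ n) = int n * v x"
  by (induction n) (simp_all add: mult algebra_simps)

lemma v_powi: "x \<noteq> 0 \<Longrightarrow> v (x powi k) = k * v x"
  by (cases "0 \<le> k") (simp_all add: power_int_def v_power v_inverse)

lemma val_ge_zero [simp]: "0 \<in> val_ge v m"
  by (simp add: val_ge_def)

lemma val_ge_one [simp]: "1 \<in> val_ge v 0"
  by (simp add: val_ge_def)

lemma val_ge_add: "x \<in> val_ge v m \<Longrightarrow> y \<in> val_ge v m \<Longrightarrow> x + y \<in> val_ge v m"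
  using add[of x y] by (cases "x = 0 \<or> y = 0 \<or> x + y = 0") (auto simp: val_ge_def)

lemma val_ge_minus: "x \<in> val_ge v m \<Longrightarrow> - x \<in> val_ge v m"
  by (auto simp: val_ge_def)

lemma val_ge_diff: "x \<in> val_ge v m \<Longrightarrow> y \<in> val_ge v m \<Longrightarrow> x - y \<in> val_ge v m"
  using val_ge_add[of x m "- y"] val_ge_minus[of y m] by simp

lemma val_ge_mult: "x \<in> val_ge v i \<Longrightarrow> y \<in> val_ge v j \<Longrightarrow> x * y \<in> val_ge v (i + j)"
  by (cases "x = 0 \<or> y = 0") (auto simp: val_ge_def mult)

lemma val_ge_mult0: "x \<in> val_ge v 0 \<Longrightarrow> y \<in> val_ge v j \<Longrightarrow> x * y \<in> val_ge v j"
  using val_ge_mult[of x 0 y j] by simp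

lemma val_ge_mult0': "x \<in> val_ge v j \<Longrightarrow> y \<in> val_ge v 0 \<Longrightarrow> x * y \<in> val_ge v j"
  using val_ge_mult[of x j y 0] by simp

lemma val_ge_mono: "x \<in> val_ge v i \<Longrightarrow> j \<le> i \<Longrightarrow> x \<in> val_ge v j"
  by (auto simp: val_ge_def)

lemma val_ge_sum: "(\<And>b. b \<in> B \<Longrightarrow> f b \<in> val_ge v m) \<Longrightarrow> sum f B \<in> val_ge v m"
  by (induction B rule: infinite_finite_induct) (auto intro: val_ge_add)

lemma mem_val_ge: "x \<noteq> 0 \<Longrightarrow> x \<in> val_ge v m \<longleftrightarrow> m \<le> v x"
  by (simp add: val_ge_def)

lemma val_ge_divide: "x \<in> val_ge v i \<Longrightarrow> y \<noteq> 0 \<Longrightarrow> x / y \<in> val_ge v (i - v y)"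
  by (cases "x = 0") (auto simp: val_ge_def v_divide)

lemma mult_image_val_ge: "a \<noteq> 0 \<Longrightarrow> (*) a ` val_ge v m = val_ge v (v a + m)"
proof (intro set_eqI iffI)
  fix y assume a: "a \<noteq> 0" and "y \<in> val_ge v (v a + m)"
  then have "y / a \<in> val_ge v m"
    using val_ge_divide[of y "v a + m" a] by simp
  then show "y \<in> (*) a ` val_ge v m"
    using a by (intro image_eqI[of _ _ "y / a"]) auto
next
  fix y assume "a \<noteq> 0" "y \<in> (*) a ` val_ge v m"
  then show "y \<in> val_ge v (v a + m)"
    by (auto simp: mem_val_ge intro!: val_ge_mult)
qed

lemma all_val_ge_imp_zero:
  assumes "\<And>m. x \<in> val_ge v m"
  shows "x = 0"
  using assms[of "v x + 1"] by (auto simp: val_ge_def)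

lemma v_unit: "x \<in> val_ge v 0 \<Longrightarrow> y \<in> val_ge v 0 \<Longrightarrow> x * y = 1 \<Longrightarrow> v x = 0"
  using mult[of x y] by (cases "x = 0 \<or> y = 0") (auto simp: val_ge_def)

end

lemma int_set_has_min:
  fixes f :: "'a \<Rightarrow> int"
  assumes "x \<in> A" and "\<And>y. y \<in> A \<Longrightarrow> m \<le> f y"
  obtains z where "z \<in> A" and "\<forall>y\<in>A. f z \<le> f y"
proof -
  obtain z where z: "z \<in> A" "\<And>y. y \<in> A \<Longrightarrow> nat (f z - m) \<le> nat (f y - m)"
    using ex_has_least_nat[of "\<lambda>y. y \<in> A" x "\<lambda>y. nat (f y - m)"] assms(1) by blast
  have "f z \<le> f y" if "y \<in> A" for y
    using z(2)[OF that] assms(2)[OF that] assms(2)[OF z(1)] by linarith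
  with z(1) show thesis
    using that by blast
qed

locale ring_embedding =
  fixes emb :: "'k::field \<Rightarrow> 'l::comm_ring_1"
  assumes emb_one [simp]: "emb 1 = 1"
    and emb_add: "emb (a + b) = emb a + emb b"
    and emb_mult: "emb (a * b) = emb a * emb b"
begin

lemma emb_zero [simp]: "emb 0 = 0"
  using emb_add[of 0 0] by simp

lemma emb_minus: "emb (- a) = - emb a"
  using emb_add[of a "- a"] by (simp add: add_eq_0_iff)

lemma emb_diff: "emb (a - b) = emb a - emb b"
  using emb_add[of a "- b"] emb_minus[of b] by simp

lemma emb_power: "emb (a ^ n) = emb a ^ n"
  by (induction n) (simp_all add: emb_mult)

lemma emb_mult_inverse: "c \<noteq> 0 \<Longrightarrow> emb c * emb (inverse c) = 1"
  using emb_mult[of c "inverse c"] by simp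

lemma emb_dvd_one: "c \<noteq> 0 \<Longrightarrow> emb c dvd 1"
  using emb_mult_inverse[of c] by (metis dvd_triv_left)

lemma module_emb: "module (\<lambda>a x. emb a * x)"
  by unfold_locales (simp_all add: emb_add emb_mult algebra_simps)

lemma homothety_class_refl: "\<Lambda> \<in> homothety_class emb \<Lambda>"
  unfolding homothety_class_def by (auto intro!: exI[of _ 1])

lemma homothety_class_scale:
  assumes "c \<noteq> 0"
  shows "homothety_class emb ((*) (emb c) ` \<Lambda>) = homothety_class emb \<Lambda>"
proof -
  have eq: "(*) (emb d) ` (*) (emb c) ` \<Lambda> = (*) (emb (d * c)) ` \<Lambda>" for d
    by (simp add: image_image emb_mult mult.assoc)
  have "\<exists>d'. (*) (emb d) ` \<Lambda> = (*) (emb (d' * c)) ` \<Lambda> \<and> d' \<noteq> 0" if "d \<noteq> 0" for d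
    using assms that by (intro exI[of _ "d / c"]) simp
  moreover have "\<exists>d'. (*) (emb (d * c)) ` \<Lambda> = (*) (emb d') ` \<Lambda> \<and> d' \<noteq> 0" if "d \<noteq> 0" for d
    using assms that by (intro exI[of _ "d * c"]) simp
  ultimately show ?thesis
    unfolding homothety_class_def eq by blast
qed

lemma homothety_class_eqD:
  "homothety_class emb M = homothety_class emb \<Lambda> \<Longrightarrow> \<exists>c. c \<noteq> 0 \<and> M = (*) (emb c) ` \<Lambda>"
  using homothety_class_refl[of M] unfolding homothety_class_def by auto

lemma self_mem_adjoin:
  assumes "normalized_valuation v"
  shows "\<delta> \<in> adjoin v emb \<delta>"
proof -
  interpret normalized_valuation v by fact
  have "\<delta> = poly (map_poly emb [:0, 1:]) \<delta>" "\<forall>i. coeff [:0, 1:] i \<in> valuation_ring v"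
    by (auto simp: map_poly_pCons coeff_pCons split: nat.split)
  then show ?thesis
    unfolding adjoin_def by blast
qed

lemma adjoin_quadratic:
  assumes v: "normalized_valuation v"
    and \<delta>: "\<delta> * \<delta> = emb t * \<delta> + emb s" and t: "t \<in> valuation_ring v" and s: "s \<in> valuation_ring v"
  shows "adjoin v emb \<delta> = {emb a + emb b * \<delta> |a b. a \<in> valuation_ring v \<and> b \<in> valuation_ring v}"
    (is "_ = ?R")
proof (intro equalityI subsetI)
  interpret normalized_valuation v by fact
  have "poly (map_poly emb f) \<delta> \<in> ?R" if "\<forall>i. coeff f i \<in> valuation_ring v" for f
    using that
  proof (induction f)
    case 0
    have "emb 0 + emb 0 * \<delta> \<in> ?R"
      by (intro CollectI exI conjI) (auto simp del: emb_zero)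
    then show ?case
      by simp
  next
    case (pCons c f)
    have c: "c \<in> valuation_ring v" "\<forall>i. coeff f i \<in> valuation_ring v"
      using pCons.prems[rule_format, of 0] pCons.prems[rule_format, of "Suc _"] by auto
    then obtain a b where ab: "poly (map_poly emb f) \<delta> = emb a + emb b * \<delta>"
      "a \<in> valuation_ring v" "b \<in> valuation_ring v"
      using pCons.IH by auto
    have "poly (map_poly emb (pCons c f)) \<delta> = emb c + (emb a * \<delta> + emb b * (\<delta> * \<delta>))"
      using pCons.hyps by (simp add: map_poly_pCons ab(1) algebra_simps)
    also have "\<dots> = emb (c + b * s) + emb (a + b * t) * \<delta>"
      unfolding \<delta> by (simp add: emb_add emb_mult algebra_simps)
    finally show ?case
      using c ab t s by (blast intro: val_ge_add val_ge_mult0)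
  qed
  then show "x \<in> ?R" if "x \<in> adjoin v emb \<delta>" for x
    using that unfolding adjoin_def by blast
  fix x assume "x \<in> ?R"
  then obtain a b where ab: "x = emb a + emb b * \<delta>" "a \<in> valuation_ring v" "b \<in> valuation_ring v"
    by blast
  then have "x = poly (map_poly emb [:a, b:]) \<delta>" "\<forall>i. coeff [:a, b:] i \<in> valuation_ring v"
    by (auto simp: map_poly_pCons coeff_pCons algebra_simps split: nat.split)
  then show "x \<in> adjoin v emb \<delta>"
    unfolding adjoin_def by blast
qed

lemma lattice_has_min:
  assumes v: "normalized_valuation v" and u: "normalized_valuation u"
    and \<Lambda>: "is_lattice v emb \<Lambda>"
    and q_add: "\<And>x y. q (x + y) = q x + q y" and q_mult: "\<And>x y. q (x * y) = q x * q y"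
    and q_one: "q 1 = (1 :: 'm::field)"
    and q_int: "\<And>a. a \<in> valuation_ring v \<Longrightarrow> q (emb a) \<in> valuation_ring u"
  obtains z where "z \<in> \<Lambda>" and "q z \<noteq> 0"
    and "\<And>y. y \<in> \<Lambda> \<Longrightarrow> q y \<in> val_ge u (u (q z))"
proof -
  interpret v: normalized_valuation v by fact
  interpret u: normalized_valuation u by fact
  interpret module "\<lambda>a x. emb a * x" by (rule module_emb)
  obtain B where B: "finite B"
      "\<Lambda> = {\<Sum>b\<in>B. emb (c b) * b |c. \<forall>b\<in>B. c b \<in> valuation_ring v}"
    using \<Lambda> unfolding is_lattice_def by blast
  have sp: "span \<Lambda> = UNIV"
    using \<Lambda> unfolding is_lattice_def by blast
  have q0: "q 0 = 0"
    using q_add[of 0 0] by (metis add.right_neutral add_left_cancel)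
  have q_sum: "q (sum f A) = (\<Sum>b\<in>A. q (f b))" for f and A :: "'l set"
    by (induction A rule: infinite_finite_induct) (simp_all add: q0 q_add)
  define m where "m = Min (insert 0 ((\<lambda>b. u (q b)) ` B))"
  have bound: "q y \<in> val_ge u m" if "y \<in> \<Lambda>" for y
  proof -
    obtain c where c: "y = (\<Sum>b\<in>B. emb (c b) * b)" "\<forall>b\<in>B. c b \<in> valuation_ring v"
      using \<open>y \<in> \<Lambda>\<close> B(2) by blast
    have "q b \<in> val_ge u m" if "b \<in> B" for b
      using that B(1) unfolding m_def val_ge_def by auto
    then show ?thesis
      unfolding c(1) q_sum q_mult using c(2) q_int by (auto intro!: u.val_ge_sum u.val_ge_mult0)
  qed
  have "\<exists>y\<in>\<Lambda>. q y \<noteq> 0"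
  proof (rule ccontr)
    assume "\<not> (\<exists>y\<in>\<Lambda>. q y \<noteq> 0)"
    then have "\<Lambda> \<subseteq> {y. q y = 0}"
      by blast
    moreover have "subspace {y. q y = 0}"
      by (rule subspaceI) (simp_all add: q0 q_add q_mult)
    ultimately have "span \<Lambda> \<subseteq> {y. q y = 0}"
      by (rule span_minimal)
    then have "q 1 = 0"
      unfolding sp by blast
    with q_one show False
      by simp
  qed
  then obtain y where "y \<in> {y \<in> \<Lambda>. q y \<noteq> 0}"
    by blast
  moreover have "m \<le> u (q y)" if "y \<in> {y \<in> \<Lambda>. q y \<noteq> 0}" for y
    using bound[of y] that by (simp add: val_ge_def)
  ultimately obtain z where z: "z \<in> {y \<in> \<Lambda>. q y \<noteq> 0}"
      "\<forall>y\<in>{y \<in> \<Lambda>. q y \<noteq> 0}. u (q z) \<le> u (q y)"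
    by (rule int_set_has_min[where f = "\<lambda>y. u (q y)"]) blast
  show thesis
    using z by (intro that[of z]) (auto simp: val_ge_def)
qed

end

context local_field
begin

lemma finite_residues:
  assumes p: "p \<noteq> 0" "v p = 1"
  shows "\<exists>T. finite T \<and> (\<forall>a\<in>valuation_ring v. \<exists>r\<in>T. a - r \<in> val_ge v (int N))"
proof (induction N)
  case 0
  show ?case
    by (intro exI[of _ "{0}"]) simp
next
  case (Suc N)
  obtain C where C: "C \<subseteq> valuation_ring v" "finite C"
      "(\<lambda>x. (+) x ` val_ge v 1) ` valuation_ring v = (\<lambda>x. (+) x ` val_ge v 1) ` C"
    using finite_subset_image[OF finite_residue_field subset_refl] by (elim exE conjE) (rule that; assumption)
  have res: "\<exists>r\<in>C. a - r \<in> val_ge v 1" if a: "a \<in> valuation_ring v" for a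
  proof -
    have "(+) a ` val_ge v 1 \<in> (\<lambda>x. (+) x ` val_ge v 1) ` C"
      unfolding C(3)[symmetric] using a by (rule imageI)
    then obtain r where r: "r \<in> C" "(+) a ` val_ge v 1 = (+) r ` val_ge v 1"
      by (rule imageE)
    have "a \<in> (+) a ` val_ge v 1"
      by (rule image_eqI[of _ _ 0]) simp_all
    then obtain y where "a = r + y" "y \<in> val_ge v 1"
      unfolding r(2) by (rule imageE)
    then show ?thesis
      using r(1) by (intro bexI[of _ r]) simp_all
  qed
  obtain T where T: "finite T" "\<And>a. a \<in> valuation_ring v \<Longrightarrow> \<exists>r\<in>T. a - r \<in> val_ge v (int N)"
    using Suc.IH by blast
  have "\<exists>z\<in>(\<lambda>(r, c). r + p ^ N * c) ` (T \<times> C). a - z \<in> val_ge v (int (Suc N))"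
    if a: "a \<in> valuation_ring v" for a
  proof -
    obtain r where r: "r \<in> T" "a - r \<in> val_ge v (int N)"
      using T(2)[OF a] by blast
    have "(a - r) / p ^ N \<in> valuation_ring v"
      using val_ge_divide[OF r(2), of "p ^ N"] p by (simp add: v_power)
    then obtain c where c: "c \<in> C" "(a - r) / p ^ N - c \<in> val_ge v 1"
      using res by blast
    have "p ^ N \<in> val_ge v (int N)"
      using p by (simp add: mem_val_ge v_power)
    moreover have "p ^ N * ((a - r) / p ^ N - c) = a - (r + p ^ N * c)"
      using p(1) by (simp add: field_simps)
    ultimately have "a - (r + p ^ N * c) \<in> val_ge v (int (Suc N))"
      using val_ge_mult[OF _ c(2), of "p ^ N" "int N"] by (simp add: add.commute)
    with r(1) c(1) show ?thesis
      by (intro bexI[of _ "r + p ^ N * c"]) (auto intro!: image_eqI[of _ _ "(r, c)"])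
  qed
  with T(1) C(2) show ?case
    by (intro exI[of _ "(\<lambda>(r, c). r + p ^ N * c) ` (T \<times> C)"]) blast
qed

text \<open>Hensel's lemma in the only case needed, where it is the contraction principle.\<close>

lemma quadratic_fixed_point:
  assumes a: "a \<in> val_ge v 1" and b: "b \<in> valuation_ring v"
  obtains z where "z \<in> valuation_ring v" and "z = a * z ^ 2 + b"
proof -
  define X where "X = rec_nat 0 (\<lambda>_ x. a * x ^ 2 + b)"
  have X_Suc: "X (Suc i) = a * X i ^ 2 + b" and X_0: "X 0 = 0" for i
    by (simp_all add: X_def)
  have a0: "a \<in> valuation_ring v"
    using a by (rule val_ge_mono) simp
  have X_int: "X i \<in> valuation_ring v" for i
    by (induction i)
       (auto simp: X_0 X_Suc power2_eq_square intro!: val_ge_add val_ge_mult0 a0 b)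
  have step: "X (Suc i) - X i \<in> val_ge v (int i)" for i
  proof (induction i)
    case 0
    show ?case
      using X_int[of "Suc 0"] by (simp add: X_0)
  next
    case (Suc i)
    have "X (Suc (Suc i)) - X (Suc i) = a * (X (Suc i) - X i) * (X (Suc i) + X i)"
      unfolding X_Suc[of "Suc i"] by (subst (2) X_Suc) (simp add: power2_eq_square algebra_simps)
    also have "\<dots> \<in> val_ge v (1 + int i)"
      using a Suc.IH by (intro val_ge_mult0' val_ge_mult val_ge_add X_int)
    finally show ?case
      by (simp add: add.commute)
  qed
  have tail: "X (i + j) - X i \<in> val_ge v (int i)" for i j
  proof (induction j)
    case (Suc j)
    have "X (Suc (i + j)) - X (i + j) \<in> val_ge v (int i)"
      using step[of "i + j"] by (rule val_ge_mono) simp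
    from val_ge_add[OF this Suc.IH] show ?case
      by simp
  qed simp
  have "\<exists>N. \<forall>i\<ge>N. \<forall>j\<ge>N. X i - X j \<in> val_ge v m" for m
  proof (intro exI allI impI)
    fix i j assume ij: "i \<ge> nat m" "j \<ge> nat m"
    have "X i - X (nat m) \<in> val_ge v m" "X j - X (nat m) \<in> val_ge v m"
      using tail[of "nat m" "i - nat m"] tail[of "nat m" "j - nat m"] ij
      by (auto elim!: val_ge_mono)
    from val_ge_diff[OF this] show "X i - X j \<in> val_ge v m"
      by simp
  qed
  then obtain z where z: "\<And>m. \<exists>N. \<forall>i\<ge>N. X i - z \<in> val_ge v m"
    using complete[of X] by blast
  have z_int: "z \<in> valuation_ring v"
  proof -
    obtain i where "X i - z \<in> valuation_ring v"
      using z[of 0] by blast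
    from val_ge_diff[OF X_int[of i] this] show ?thesis
      by simp
  qed
  have "z - (a * z ^ 2 + b) \<in> val_ge v m" for m
  proof -
    obtain N where N: "\<forall>i\<ge>N. X i - z \<in> val_ge v m"
      using z by blast
    then have N': "X N - z \<in> val_ge v m" "X (Suc N) - z \<in> val_ge v m"
      by auto
    have "a * ((X N + z) * (X N - z)) \<in> val_ge v m"
      using N' by (intro val_ge_mult0 a0 val_ge_add X_int z_int)
    from val_ge_diff[OF this N'(2)] show ?thesis
      by (simp add: X_Suc power2_eq_square algebra_simps)
  qed
  then have "z - (a * z ^ 2 + b) = 0"
    by (rule all_val_ge_imp_zero)
  with z_int show thesis
    by (intro that) simp_all
qed

end


context ring_embedding
begin

lemma lattice_closed:
  assumes v: "normalized_valuation v" and \<Lambda>: "is_lattice v emb \<Lambda>"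
  shows lattice_add: "x \<in> \<Lambda> \<Longrightarrow> y \<in> \<Lambda> \<Longrightarrow> x + y \<in> \<Lambda>"
    and lattice_scale: "c \<in> valuation_ring v \<Longrightarrow> x \<in> \<Lambda> \<Longrightarrow> emb c * x \<in> \<Lambda>"
proof -
  interpret normalized_valuation v by fact
  obtain B where B: "\<Lambda> = {\<Sum>b\<in>B. emb (c b) * b |c. \<forall>b\<in>B. c b \<in> valuation_ring v}"
    using \<Lambda> unfolding is_lattice_def by blast
  show "x + y \<in> \<Lambda>" if xy: "x \<in> \<Lambda>" "y \<in> \<Lambda>"
  proof -
    obtain c d where "x = (\<Sum>b\<in>B. emb (c b) * b)" "y = (\<Sum>b\<in>B. emb (d b) * b)"
      and cd: "\<forall>b\<in>B. c b \<in> valuation_ring v" "\<forall>b\<in>B. d b \<in> valuation_ring v"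
      using xy B by blast
    then have "x + y = (\<Sum>b\<in>B. emb (c b + d b) * b)"
      by (simp add: emb_add distrib_right sum.distrib)
    moreover have "\<forall>b\<in>B. c b + d b \<in> valuation_ring v"
      using cd by (auto intro: val_ge_add)
    ultimately show ?thesis
      unfolding B by (intro CollectI exI[of _ "\<lambda>b. c b + d b"]) simp
  qed
  show "emb c * x \<in> \<Lambda>" if c: "c \<in> valuation_ring v" and x: "x \<in> \<Lambda>"
  proof -
    obtain d where "x = (\<Sum>b\<in>B. emb (d b) * b)" and d: "\<forall>b\<in>B. d b \<in> valuation_ring v"
      using x B by blast
    then have "emb c * x = (\<Sum>b\<in>B. emb (c * d b) * b)"
      by (simp add: emb_mult sum_distrib_left mult.assoc)
    moreover have "\<forall>b\<in>B. c * d b \<in> valuation_ring v"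
      using c d by (auto intro: val_ge_mult0)
    ultimately show ?thesis
      unfolding B by (intro CollectI exI[of _ "\<lambda>b. c * d b"]) simp
  qed
qed

end

lemma inj_mult_unit:
  fixes \<alpha> :: "'a::comm_ring_1"
  assumes "\<alpha> dvd 1"
  shows "inj ((*) \<alpha>)"
proof (rule injI)
  fix x y assume eq: "\<alpha> * x = \<alpha> * y"
  obtain \<beta> where \<beta>: "1 = \<alpha> * \<beta>"
    using assms by (rule dvdE)
  have "x = \<beta> * (\<alpha> * x)" "y = \<beta> * (\<alpha> * y)"
    using \<beta> by (simp_all add: mult.assoc[symmetric] mult.commute[of \<beta>] flip: \<beta>)
  with eq show "x = y"
    by simp
qed

text \<open>The three kinds of quadratic \<open>K\<close>-algebra enter the argument only through the following data.
  Assumption \<open>primitive\<close> says that a lattice can be scaled by a unit of \<open>L\<close> so that it contains \<open>1\<close> and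
  lies in the maximal order, and \<open>basin\<close> that the basin consists of the classes of the invertible
  fractional ideals of the maximal order.\<close>

locale quadratic_order = local_field v + ring_embedding emb
  for v :: "'k::field \<Rightarrow> int" and emb :: "'k \<Rightarrow> 'l::comm_ring_1" +
  fixes p :: 'k and \<Delta> :: 'l and t s :: 'k and val :: "'l \<Rightarrow> 't::{comm_ring_1, ord}" and e :: 't
    and P :: "'l set set set"
  assumes p_nonzero: "p \<noteq> 0" and v_p: "v p = 1"
    and Delta_sq: "\<Delta> * \<Delta> = emb t * \<Delta> + emb s"
    and t_int: "t \<in> valuation_ring v" and s_int: "s \<in> valuation_ring v"
    and indep: "emb a + emb b * \<Delta> = 0 \<Longrightarrow> a = 0 \<and> b = 0"
    and spans: "\<exists>a b. y = emb a + emb b * \<Delta>"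
    and val_mult: "x dvd 1 \<Longrightarrow> y dvd 1 \<Longrightarrow> val (x * y) = val x + val y"
    and val_emb: "c \<noteq> 0 \<Longrightarrow> val (emb c) = of_int (v c) * e"
    and val_unit: "x \<in> adjoin v emb \<Delta> \<Longrightarrow> y \<in> adjoin v emb \<Delta> \<Longrightarrow> x * y = 1 \<Longrightarrow> val x = 0"
    and e_order: "0 \<le> of_int k * e \<longleftrightarrow> 0 \<le> k"
    and primitive: "is_lattice v emb \<Lambda> \<Longrightarrow>
      \<exists>\<alpha>\<in>\<Lambda>. \<exists>\<beta>. \<alpha> * \<beta> = 1 \<and> (*) \<beta> ` \<Lambda> \<subseteq> adjoin v emb \<Delta>"
    and basin: "P = {homothety_class emb ((*) \<alpha> ` adjoin v emb \<Delta>) |\<alpha>. \<alpha> dvd 1}"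
begin

abbreviation R :: "nat \<Rightarrow> 'l set" where
  "R n \<equiv> order_ring v p emb \<Delta> n"

lemma R_0: "R 0 = adjoin v emb \<Delta>"
  by (simp add: order_ring_def)

lemma basis_eq_iff: "emb a + emb b * \<Delta> = emb c + emb d * \<Delta> \<longleftrightarrow> a = c \<and> b = d"
  using indep[of "a - c" "b - d"] by (auto simp: emb_diff algebra_simps)

lemma R_eq_span:
  "R n = {emb a + emb b * (emb (p ^ n) * \<Delta>) |a b. a \<in> valuation_ring v \<and> b \<in> valuation_ring v}"
proof -
  have p: "p ^ i \<in> valuation_ring v" for i
    using p_nonzero by (simp add: mem_val_ge v_power v_p)
  have "(emb (p ^ n) * \<Delta>) * (emb (p ^ n) * \<Delta>) = emb (p ^ n) * emb (p ^ n) * (\<Delta> * \<Delta>)"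
    by (simp add: algebra_simps)
  also have "\<dots> = emb (p ^ n * t) * (emb (p ^ n) * \<Delta>) + emb (p ^ n * p ^ n * s)"
    unfolding Delta_sq by (simp add: emb_mult algebra_simps)
  finally show ?thesis
    unfolding order_ring_def emb_power[symmetric]
    by (rule adjoin_quadratic[OF normalized_valuation_axioms])
       (auto intro!: val_ge_mult0 t_int s_int p)
qed

lemma R_eq: "R n = {emb a + emb b * \<Delta> |a b. a \<in> valuation_ring v \<and> b \<in> val_ge v (int n)}"
proof -
  have "val_ge v (int n) = (*) (p ^ n) ` valuation_ring v"
    using p_nonzero by (simp add: mult_image_val_ge v_power v_p)
  then show ?thesis
    unfolding R_eq_span by (force simp: emb_mult algebra_simps)
qed

lemma mem_R_iff: "emb a + emb b * \<Delta> \<in> R n \<longleftrightarrow> a \<in> valuation_ring v \<and> b \<in> val_ge v (int n)"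
  unfolding R_eq by (auto simp: basis_eq_iff)

lemma emb_mem_R: "a \<in> valuation_ring v \<Longrightarrow> emb a \<in> R n"
  using mem_R_iff[of a 0 n] by simp

lemma one_mem_R: "1 \<in> R n"
  using emb_mem_R[of 1 n] by simp

lemma R_mult:
  assumes "x \<in> R n" "y \<in> R n"
  shows "x * y \<in> R n"
proof -
  obtain a b c d where x: "x = emb a + emb b * \<Delta>" and y: "y = emb c + emb d * \<Delta>"
    and ab: "a \<in> valuation_ring v" "b \<in> val_ge v (int n)"
    and cd: "c \<in> valuation_ring v" "d \<in> val_ge v (int n)"
    using assms unfolding R_eq by blast
  have "x * y = emb (a * c) + emb (a * d + b * c) * \<Delta> + emb (b * d) * (\<Delta> * \<Delta>)"
    unfolding x y by (simp add: emb_add emb_mult algebra_simps)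
  also have "\<dots> = emb (a * c + b * d * s) + emb (a * d + b * c + b * d * t) * \<Delta>"
    unfolding Delta_sq by (simp add: emb_add emb_mult algebra_simps)
  also have "\<dots> \<in> R n"
  proof -
    have "b \<in> valuation_ring v" "d \<in> valuation_ring v"
      using ab cd by (auto elim: val_ge_mono)
    with ab cd show ?thesis
      unfolding mem_R_iff
      by (intro conjI val_ge_add) (blast intro: val_ge_mult0 val_ge_mult0' s_int t_int)+
  qed
  finally show ?thesis .
qed

lemma emb_unit_image_R:
  assumes "u \<noteq> 0" "v u = 0"
  shows "(*) (emb u) ` R n = R n"
proof (intro equalityI subsetI)
  fix y assume y: "y \<in> R n"
  have "inverse u \<in> valuation_ring v"
    using assms by (simp add: mem_val_ge v_inverse)
  then have "emb (inverse u) * y \<in> R n"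
    using y by (intro R_mult emb_mem_R)
  moreover have "y = emb u * (emb (inverse u) * y)"
    using emb_mult_inverse[OF assms(1)] by (simp add: mult.assoc[symmetric])
  ultimately show "y \<in> (*) (emb u) ` R n"
    by blast
next
  have "u \<in> valuation_ring v"
    using assms by (simp add: mem_val_ge)
  then show "y \<in> R n" if "y \<in> (*) (emb u) ` R n" for y
    using that by (auto intro: R_mult emb_mem_R)
qed

lemma R_Suc_psubset: "R (Suc m) \<subset> R m"
proof
  show "R (Suc m) \<subseteq> R m"
    unfolding R_eq using val_ge_mono[of _ "int (Suc m)" "int m"] by fastforce
  have "p ^ m \<in> val_ge v (int m)" "p ^ m \<notin> val_ge v (int (Suc m))"
    using p_nonzero by (simp_all add: mem_val_ge v_power v_p)
  then show "R (Suc m) \<noteq> R m"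
    using mem_R_iff[of 0 "p ^ m" m] mem_R_iff[of 0 "p ^ m" "Suc m"] by auto
qed

lemma p_R_psubset: "(*) (emb p) ` R m \<subset> R (Suc m)"
proof
  have "p \<in> val_ge v 1"
    using p_nonzero by (simp add: mem_val_ge v_p)
  then have int: "p * a \<in> valuation_ring v" "p * b \<in> val_ge v (int (Suc m))"
    if "a \<in> valuation_ring v" "b \<in> val_ge v (int m)" for a b
    using val_ge_mult[of p 1 a 0] val_ge_mult[of p 1 b "int m"] that
    by (auto elim: val_ge_mono)
  have scale: "emb p * (emb a + emb b * \<Delta>) = emb (p * a) + emb (p * b) * \<Delta>" for a b
    by (simp add: emb_mult algebra_simps)
  show "(*) (emb p) ` R m \<subseteq> R (Suc m)"
  proof
    fix y assume "y \<in> (*) (emb p) ` R m"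
    then obtain a b where "y = emb (p * a) + emb (p * b) * \<Delta>"
      "a \<in> valuation_ring v" "b \<in> val_ge v (int m)"
      unfolding R_eq using scale by auto
    then show "y \<in> R (Suc m)"
      using int by (simp only: mem_R_iff)
  qed
  have "1 \<notin> (*) (emb p) ` R m"
  proof
    assume "1 \<in> (*) (emb p) ` R m"
    then obtain a b where "emb 1 + emb 0 * \<Delta> = emb (p * a) + emb (p * b) * \<Delta>"
      and a: "a \<in> valuation_ring v"
      unfolding R_eq using scale by auto
    then have pa: "p * a = 1"
      unfolding basis_eq_iff by simp
    then have "v p + v a = 0"
      using mult[of p a] p_nonzero by (cases "a = 0") auto
    with a pa show False
      by (auto simp: val_ge_def v_p)
  qed
  then show "(*) (emb p) ` R m \<noteq> R (Suc m)"
    using one_mem_R by auto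
qed

lemma is_lattice_unit_R:
  assumes "\<alpha> dvd 1"
  shows "is_lattice v emb ((*) \<alpha> ` R n)"
proof -
  interpret module "\<lambda>a x. emb a * x" by (rule module_emb)
  define \<delta> where "\<delta> = emb (p ^ n) * \<Delta>"
  obtain \<beta> where \<beta>: "1 = \<alpha> * \<beta>"
    using assms by (rule dvdE)
  have "\<delta> \<noteq> 1"
    using basis_eq_iff[of 0 "p ^ n" 1 0] by (auto simp: \<delta>_def)
  then have ne: "\<alpha> \<noteq> \<alpha> * \<delta>"
    using inj_mult_unit[OF assms] by (metis injD mult.right_neutral)
  have "(*) \<alpha> ` R n = {\<Sum>b\<in>{\<alpha>, \<alpha> * \<delta>}. emb (c b) * b |c. \<forall>b\<in>{\<alpha>, \<alpha> * \<delta>}. c b \<in> valuation_ring v}"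
    (is "_ = ?B")
  proof (intro equalityI subsetI)
    fix y assume "y \<in> (*) \<alpha> ` R n"
    then obtain a b where y: "y = \<alpha> * (emb a + emb b * \<delta>)"
      and ab: "a \<in> valuation_ring v" "b \<in> valuation_ring v"
      unfolding R_eq_span \<delta>_def by blast
    define c where "c = (\<lambda>x. if x = \<alpha> then a else b)"
    have "y = (\<Sum>b\<in>{\<alpha>, \<alpha> * \<delta>}. emb (c b) * b)" "\<forall>b\<in>{\<alpha>, \<alpha> * \<delta>}. c b \<in> valuation_ring v"
      using ne ab by (auto simp: c_def y algebra_simps)
    then show "y \<in> ?B"
      by blast
  next
    fix y assume "y \<in> ?B"
    then obtain c where y: "y = (\<Sum>b\<in>{\<alpha>, \<alpha> * \<delta>}. emb (c b) * b)"
      and c: "c \<alpha> \<in> valuation_ring v" "c (\<alpha> * \<delta>) \<in> valuation_ring v"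
      by blast
    have "y = \<alpha> * (emb (c \<alpha>) + emb (c (\<alpha> * \<delta>)) * \<delta>)"
      unfolding y using ne by (simp add: algebra_simps)
    moreover have "emb (c \<alpha>) + emb (c (\<alpha> * \<delta>)) * \<delta> \<in> R n"
      unfolding R_eq_span \<delta>_def using c unfolding \<delta>_def by blast
    ultimately show "y \<in> (*) \<alpha> ` R n"
      by blast
  qed
  moreover have "y \<in> span ((*) \<alpha> ` R n)" for y
  proof -
    obtain a b where ab: "\<beta> * y = emb a + emb b * \<Delta>"
      using spans by blast
    have "y = \<alpha> * (\<beta> * y)"
      using \<beta> by (simp add: mult.assoc[symmetric])
    also have "\<beta> * y = emb a + emb (b / p ^ n) * \<delta>"
      unfolding \<delta>_def mult.assoc[symmetric] emb_mult[symmetric] using ab p_nonzero by simp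
    finally have "y = emb a * (\<alpha> * 1) + emb (b / p ^ n) * (\<alpha> * \<delta>)"
      by (simp add: algebra_simps)
    moreover have "\<delta> \<in> R n"
      using mem_R_iff[of 0 "p ^ n" n] p_nonzero by (simp add: \<delta>_def mem_val_ge v_power v_p)
    ultimately show ?thesis
      using one_mem_R by (metis span_add span_scale span_base imageI)
  qed
  ultimately show ?thesis
    unfolding is_lattice_def by (intro conjI exI[of _ "{\<alpha>, \<alpha> * \<delta>}"]) auto
qed

text \<open>An \<open>O\<^sub>K\<close>-module between \<open>O\<^sub>K\<close> and \<open>O\<^sub>K + O\<^sub>K \<Delta>\<close> is determined by its image in the cyclic
  quotient \<open>O\<^sub>K \<Delta>\<close>.\<close>

lemma lattice_eq_unit_R:
  assumes \<Lambda>: "is_lattice v emb \<Lambda>"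
  obtains \<alpha> m where "\<alpha> dvd 1" and "\<Lambda> = (*) \<alpha> ` R m"
proof -
  interpret module "\<lambda>a x. emb a * x" by (rule module_emb)
  note lattice = lattice_closed[OF normalized_valuation_axioms \<Lambda>]
  obtain \<alpha> \<beta> where \<alpha>: "\<alpha> \<in> \<Lambda>" and \<alpha>\<beta>: "\<alpha> * \<beta> = 1" and sub: "(*) \<beta> ` \<Lambda> \<subseteq> R 0"
    using primitive[OF \<Lambda>] unfolding R_0 by blast
  have unit: "\<alpha> dvd 1"
    using \<alpha>\<beta> by (metis dvd_triv_left)
  have cancel: "\<alpha> * (\<beta> * x) = x" "\<beta> * (\<alpha> * x) = x" for x
    using \<alpha>\<beta> by (simp_all add: mult.assoc[symmetric] mult.commute[of \<beta> \<alpha>])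
  define N where "N = {x. \<alpha> * x \<in> \<Lambda>}"
  have \<Lambda>_N: "\<Lambda> = (*) \<alpha> ` N"
    unfolding N_def using cancel
    by (metis (no_types, lifting) image_Collect_subsetI image_eqI mem_Collect_eq subsetI
        subset_antisym)
  have N_sub: "N \<subseteq> R 0"
    using sub cancel unfolding N_def
    by (metis (no_types, lifting) image_subset_iff mem_Collect_eq subsetI)
  have N_one: "1 \<in> N"
    using \<alpha> by (simp add: N_def)
  have N_add: "x + y \<in> N" if "x \<in> N" "y \<in> N" for x y
    using that lattice(1) by (simp add: N_def distrib_left)
  have N_scale: "emb c * x \<in> N" if "c \<in> valuation_ring v" "x \<in> N" for c x
    using that lattice(2)[of c "\<alpha> * x"] by (simp add: N_def algebra_simps)
  have N_emb: "emb c \<in> N" if "c \<in> valuation_ring v" for c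
    using N_scale[OF that N_one] by simp
  define S where "S = {b. b \<noteq> 0 \<and> (\<exists>a. emb a + emb b * \<Delta> \<in> N)}"
  have "S \<noteq> {}"
  proof
    assume "S = {}"
    have "\<Lambda> \<subseteq> range (\<lambda>a. \<alpha> * emb a)"
    proof
      fix y assume "y \<in> \<Lambda>"
      then obtain x where x: "x \<in> N" "y = \<alpha> * x"
        using \<Lambda>_N by blast
      moreover obtain a b where "x = emb a + emb b * \<Delta>"
        using spans by blast
      ultimately show "y \<in> range (\<lambda>a. \<alpha> * emb a)"
        using \<open>S = {}\<close> unfolding S_def by (cases "b = 0") auto
    qed
    moreover have "subspace (range (\<lambda>a. \<alpha> * emb a))"
    proof (rule subspaceI)
      show "0 \<in> range (\<lambda>a. \<alpha> * emb a)"
        by (intro range_eqI[of _ _ 0]) simp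
    next
      fix x y assume "x \<in> range (\<lambda>a. \<alpha> * emb a)" "y \<in> range (\<lambda>a. \<alpha> * emb a)"
      then obtain a b where "x + y = \<alpha> * emb (a + b)"
        by (auto simp: emb_add distrib_left)
      then show "x + y \<in> range (\<lambda>a. \<alpha> * emb a)"
        by blast
    next
      fix c x assume "x \<in> range (\<lambda>a. \<alpha> * emb a)"
      then obtain a where "x = \<alpha> * emb a"
        by blast
      then have "emb c * x = \<alpha> * emb (c * a)"
        by (simp add: emb_mult algebra_simps)
      then show "emb c * x \<in> range (\<lambda>a. \<alpha> * emb a)"
        by blast
    qed
    ultimately have "span \<Lambda> \<subseteq> range (\<lambda>a. \<alpha> * emb a)"
      by (rule span_minimal)
    then have "\<alpha> * \<Delta> \<in> range (\<lambda>a. \<alpha> * emb a)"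
      using \<Lambda> unfolding is_lattice_def by blast
    then obtain a where "\<Delta> = emb a"
      using inj_mult_unit[OF unit] by (auto dest: injD)
    then show False
      using basis_eq_iff[of 0 1 a 0] by simp
  qed
  then obtain b1 where "b1 \<in> S"
    by blast
  moreover have "0 \<le> v b" if "b \<in> S" for b
    using that N_sub mem_R_iff[of _ b 0] by (auto simp: S_def mem_val_ge)
  ultimately obtain b0 where b0: "b0 \<in> S" "\<forall>b\<in>S. v b0 \<le> v b"
    by (rule int_set_has_min[where f = v]) blast
  define m where "m = nat (v b0)"
  have m: "int m = v b0"
    using \<open>\<And>b. b \<in> S \<Longrightarrow> 0 \<le> v b\<close>[OF b0(1)] by (simp add: m_def)
  obtain a0 where a0: "emb a0 + emb b0 * \<Delta> \<in> N" and b0_nz: "b0 \<noteq> 0"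
    using b0(1) by (auto simp: S_def)
  have a0_int: "a0 \<in> valuation_ring v"
    using a0 N_sub mem_R_iff[of a0 b0 0] by blast
  have "N = R m"
  proof (intro equalityI subsetI)
    fix y assume y: "y \<in> N"
    obtain a b where ab: "y = emb a + emb b * \<Delta>"
      using spans by blast
    have "a \<in> valuation_ring v"
      using y N_sub mem_R_iff[of a b 0] unfolding ab by blast
    moreover have "b \<in> val_ge v (int m)"
      using b0(2) y unfolding m ab S_def val_ge_def by blast
    ultimately show "y \<in> R m"
      unfolding ab mem_R_iff by blast
  next
    fix y assume "y \<in> R m"
    then obtain a b where y: "y = emb a + emb b * \<Delta>"
      and a: "a \<in> valuation_ring v" and b: "b \<in> val_ge v (int m)"
      unfolding R_eq by blast
    have c: "b / b0 \<in> valuation_ring v"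
      using val_ge_divide[OF b b0_nz] by (simp add: m)
    have "y = emb (b / b0) * (emb a0 + emb b0 * \<Delta>) + emb (a - b / b0 * a0)"
      unfolding distrib_left mult.assoc[symmetric] emb_mult[symmetric] y
      using b0_nz by (simp add: emb_diff)
    then show "y \<in> N"
      using N_add[OF N_scale[OF c a0] N_emb] val_ge_diff[OF a val_ge_mult0[OF c a0_int]] by simp
  qed
  with \<Lambda>_N unit show thesis
    using that by blast
qed

lemma class_unit_R_in_nbhd:
  assumes "\<alpha> dvd 1"
  shows "homothety_class emb ((*) \<alpha> ` R m) \<in> basin_nbhd v p emb P m"
proof (induction m)
  case 0
  show ?case
    using assms by (auto simp: basin R_0)
next
  case (Suc m)
  let ?x = "homothety_class emb ((*) \<alpha> ` R (Suc m))" and ?s = "homothety_class emb ((*) \<alpha> ` R m)"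
  let ?M = "(*) (emb p * \<alpha>) ` R m"
  have M: "?M = (*) (emb p) ` (*) \<alpha> ` R m" "?M = (*) \<alpha> ` (*) (emb p) ` R m"
    by (auto simp: image_image algebra_simps)
  have punit: "emb p dvd 1"
    using p_nonzero by (rule emb_dvd_one)
  have "(*) (emb p) ` (*) \<alpha> ` R (Suc m) \<subset> ?M"
    unfolding M(1) using R_Suc_psubset inj_mult_unit[OF assms] inj_mult_unit[OF punit]
    by (intro image_strict_mono) (auto intro: inj_on_subset)
  moreover have "?M \<subset> (*) \<alpha> ` R (Suc m)"
    unfolding M(2) using p_R_psubset inj_mult_unit[OF assms]
    by (intro image_strict_mono) (auto intro: inj_on_subset)
  moreover have "is_lattice v emb ?M"
    using assms punit by (intro is_lattice_unit_R) (metis mult_1 mult_dvd_mono)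
  moreover have "homothety_class emb ?M = ?s"
    unfolding M(1) using p_nonzero by (rule homothety_class_scale)
  ultimately have "(?x, ?s) \<in> adjacency v p emb"
    unfolding adjacency_def using is_lattice_unit_R[OF assms, of "Suc m"]
    by (intro CollectI exI[of _ "(*) \<alpha> ` R (Suc m)"] exI[of _ ?M]) auto
  then have "tree_dist v p emb ?x ?s \<le> 1"
    unfolding tree_dist_def by (intro INF_lower2[of 1]) (auto simp: one_enat_def)
  then have "tree_setdist v p emb ?x (basin_nbhd v p emb P m) \<le> 1"
    unfolding tree_setdist_def using Suc.IH by (rule INF_lower2[rotated])
  then show ?case
    using is_lattice_unit_R[OF assms, of "Suc m"] by (simp add: vertices_def)
qed

lemma nbhd_imp_class_unit_R:
  assumes "x \<in> basin_nbhd v p emb P k"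
  shows "\<exists>\<alpha> j. \<alpha> dvd 1 \<and> j \<le> k \<and> x = homothety_class emb ((*) \<alpha> ` R j)"
  using assms
proof (induction k arbitrary: x)
  case 0
  then show ?case
    by (auto simp: basin R_0)
next
  case (Suc k)
  then have "tree_setdist v p emb x (basin_nbhd v p emb P k) \<le> 1"
    by simp
  also have "(1::enat) < 2"
    by simp
  finally obtain y where y: "y \<in> basin_nbhd v p emb P k" and "tree_dist v p emb x y < 2"
    unfolding tree_setdist_def INF_less_iff by blast
  then obtain i where i: "(x, y) \<in> adjacency v p emb ^^ i" "enat i < 2"
    unfolding tree_dist_def INF_less_iff by blast
  obtain \<beta> j where \<beta>: "\<beta> dvd 1" "j \<le> k" "y = homothety_class emb ((*) \<beta> ` R j)"
    using Suc.IH[OF y] by blast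
  have "i = 0 \<or> i = 1"
    using i(2) by (simp add: numeral_eq_enat less_2_cases_iff)
  then show ?case
  proof
    assume "i = 0"
    with i(1) \<beta> show ?case
      by (auto intro: le_SucI)
  next
    assume "i = 1"
    then obtain \<Lambda> M where x: "x = homothety_class emb \<Lambda>" and "y = homothety_class emb M"
      and \<Lambda>: "is_lattice v emb \<Lambda>" and sub: "(*) (emb p) ` \<Lambda> \<subseteq> M" "M \<subseteq> \<Lambda>"
      using i(1) unfolding adjacency_def by auto
    then obtain c where M: "M = (*) (emb c) ` (*) \<beta> ` R j"
      using \<beta>(3) homothety_class_eqD by metis
    obtain \<alpha> m where \<alpha>: "\<alpha> dvd 1" "\<Lambda> = (*) \<alpha> ` R m"
      using lattice_eq_unit_R[OF \<Lambda>] by blast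
    have "\<alpha> \<in> \<Lambda>"
      unfolding \<alpha>(2) using one_mem_R by (intro image_eqI[of _ _ 1]) auto
    then obtain r where r: "r \<in> R j" "emb p * \<alpha> = emb c * (\<beta> * r)"
      using sub(1) M by blast
    have "emb (p ^ j) * \<Delta> \<in> R j"
      using mem_R_iff[of 0 "p ^ j" j] p_nonzero by (simp add: mem_val_ge v_power v_p)
    then have "emb c * (\<beta> * (r * (emb (p ^ j) * \<Delta>))) \<in> M"
      using r(1) M by (blast intro: R_mult)
    also have "emb c * (\<beta> * (r * (emb (p ^ j) * \<Delta>))) = (emb p * \<alpha>) * (emb (p ^ j) * \<Delta>)"
      by (simp add: r(2) mult.assoc)
    also have "\<dots> = \<alpha> * (emb (p ^ Suc j) * \<Delta>)"
      by (simp add: emb_mult algebra_simps)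
    finally have "\<alpha> * (emb (p ^ Suc j) * \<Delta>) \<in> (*) \<alpha> ` R m"
      using sub(2) \<alpha>(2) by blast
    then have "emb (p ^ Suc j) * \<Delta> \<in> R m"
      using inj_mult_unit[OF \<alpha>(1)] by (simp add: inj_image_mem_iff)
    then have "p ^ Suc j \<in> val_ge v (int m)"
      using mem_R_iff[of 0 "p ^ Suc j" m] by simp
    then have "m \<le> Suc j"
      using p_nonzero by (simp add: mem_val_ge v_power v_p del: power_Suc)
    with \<alpha> \<beta>(2) x show ?case
      by (intro exI[of _ \<alpha>] exI[of _ m]) simp
  qed
qed

lemma shell_imp_class_unit_R:
  assumes "x \<in> basin_shell v p emb P n"
  obtains \<alpha> where "\<alpha> dvd 1" and "x = homothety_class emb ((*) \<alpha> ` R n)"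
proof (cases n)
  case 0
  then show thesis
    using assms nbhd_imp_class_unit_R[of x 0] that by auto
next
  case (Suc k)
  then have x: "x \<in> basin_nbhd v p emb P (Suc k)" "x \<notin> basin_nbhd v p emb P k"
    using assms by auto
  obtain \<alpha> j where \<alpha>: "\<alpha> dvd 1" "j \<le> Suc k" "x = homothety_class emb ((*) \<alpha> ` R j)"
    using nbhd_imp_class_unit_R[OF x(1)] by blast
  have mono: "basin_nbhd v p emb P i \<subseteq> basin_nbhd v p emb P (Suc i)" for i
  proof
    fix y assume y: "y \<in> basin_nbhd v p emb P i"
    then have "y \<in> vertices v emb"
      using nbhd_imp_class_unit_R[OF y] is_lattice_unit_R by (auto simp: vertices_def)
    moreover have "tree_dist v p emb y y \<le> 1"
      unfolding tree_dist_def by (intro INF_lower2[of 0]) (auto simp: zero_enat_def[symmetric])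
    then have "tree_setdist v p emb y (basin_nbhd v p emb P i) \<le> 1"
      unfolding tree_setdist_def using y by (rule INF_lower2[rotated])
    ultimately show "y \<in> basin_nbhd v p emb P (Suc i)"
      by simp
  qed
  have "j = Suc k"
  proof (rule ccontr)
    assume "j \<noteq> Suc k"
    with \<alpha>(2) have "j \<le> k"
      by simp
    have "basin_nbhd v p emb P j \<subseteq> basin_nbhd v p emb P k"
      using mono \<open>j \<le> k\<close> by (rule lift_Suc_mono_le)
    then have "x \<in> basin_nbhd v p emb P k"
      using class_unit_R_in_nbhd[OF \<alpha>(1), of j] \<alpha>(3) by blast
    with x(2) show False ..
  qed
  with \<alpha> Suc show thesis
    using that by blast
qed

lemma ideal_type_unit_R:
  assumes "\<alpha> dvd 1"
  shows "ideal_type val (R n) ((*) \<alpha> ` R n) = val \<alpha>"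
  unfolding ideal_type_def
proof (rule the_equality)
  fix z assume "\<exists>\<gamma>. (*) \<alpha> ` R n = (*) \<gamma> ` R n \<and> z = val \<gamma>"
  then obtain \<gamma> where \<gamma>: "(*) \<alpha> ` R n = (*) \<gamma> ` R n" and z: "z = val \<gamma>"
    by blast
  have "\<gamma> \<in> (*) \<gamma> ` R n" "\<alpha> \<in> (*) \<alpha> ` R n"
    by (rule image_eqI[of _ _ 1], simp_all add: one_mem_R)+
  then obtain x y where x: "\<gamma> = \<alpha> * x" "x \<in> R n" and y: "\<alpha> = \<gamma> * y" "y \<in> R n"
    using \<gamma> by blast
  have "\<alpha> * (x * y) = \<alpha> * 1"
    using x(1) y(1) by (metis mult.assoc mult.right_neutral)
  then have xy: "x * y = 1"
    using inj_mult_unit[OF assms] by (blast dest: injD)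
  have "R n \<subseteq> R 0"
    unfolding R_eq using val_ge_mono[of _ "int n" "int 0"] by fastforce
  then have "val x = 0"
    using x(2) y(2) xy val_unit[of x y] unfolding R_0 by blast
  moreover have "x dvd 1"
    using xy by (metis dvd_triv_left)
  ultimately show "z = val \<alpha>"
    using assms val_mult by (simp add: z x(1))
qed (use assms in blast)

lemma emb_mult_mem_R_threshold:
  assumes "\<alpha> dvd 1"
  obtains m where "\<And>c. c \<noteq> 0 \<Longrightarrow> emb c * \<alpha> \<in> R n \<longleftrightarrow> m \<le> v c"
proof -
  obtain a b where \<alpha>: "\<alpha> = emb a + emb b * \<Delta>"
    using spans by blast
  have ne: "a \<noteq> 0 \<or> b \<noteq> 0"
    using assms \<alpha> basis_eq_iff[of 0 0 1 0] by auto
  define m where "m = (if a = 0 then int n - v b else if b = 0 then - v a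
    else max (int n - v b) (- v a))"
  have "emb c * \<alpha> \<in> R n \<longleftrightarrow> m \<le> v c" if "c \<noteq> 0" for c
  proof -
    have "emb c * \<alpha> = emb (c * a) + emb (c * b) * \<Delta>"
      by (simp add: \<alpha> emb_mult algebra_simps)
    then have "emb c * \<alpha> \<in> R n \<longleftrightarrow> c * a \<in> valuation_ring v \<and> c * b \<in> val_ge v (int n)"
      by (simp add: mem_R_iff)
    also have "\<dots> \<longleftrightarrow> m \<le> v c"
      using ne that by (auto simp: m_def val_ge_def mult)
    finally show ?thesis .
  qed
  then show thesis
    using that by blast
qed

lemma finite_index_unit_R:
  assumes "\<alpha> dvd 1" "\<alpha> \<in> R n"
  shows "finite ((\<lambda>y. (+) y ` (*) \<alpha> ` R n) ` R n)"
proof -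
  let ?I = "(*) \<alpha> ` R n"
  obtain \<beta> where \<beta>: "1 = \<alpha> * \<beta>"
    using assms(1) by (rule dvdE)
  then have "\<beta> dvd 1"
    by (metis dvd_triv_right)
  then obtain m where m: "\<And>c. c \<noteq> 0 \<Longrightarrow> emb c * \<beta> \<in> R n \<longleftrightarrow> m \<le> v c"
    by (rule emb_mult_mem_R_threshold[where n = n]) blast
  define N where "N = nat m"
  have small: "emb c * r \<in> ?I" if "c \<in> val_ge v (int N)" "r \<in> R n" for c r
  proof -
    have "emb c * \<beta> \<in> R n"
      using m[of c] that(1) emb_mem_R[of 0 n] by (cases "c = 0") (auto simp: N_def val_ge_def split: if_splits)
    then have "emb c * \<beta> * r \<in> R n"
      using that(2) by (rule R_mult)
    moreover have "emb c * r = \<alpha> * (emb c * \<beta> * r)"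
      using \<beta> by (metis mult.assoc mult.commute mult_1)
    ultimately show ?thesis
      by blast
  qed
  have I_add: "x + y \<in> ?I" if "x \<in> ?I" "y \<in> ?I" for x y
    using that lattice_add[OF normalized_valuation_axioms is_lattice_unit_R[OF assms(1)]] by blast
  have I_minus: "- x \<in> ?I" if "x \<in> ?I" for x
    using that lattice_scale[OF normalized_valuation_axioms is_lattice_unit_R[OF assms(1)], of "-1" x]
    by (simp add: emb_minus val_ge_minus)
  obtain T where T: "finite T" "\<And>a. a \<in> valuation_ring v \<Longrightarrow> \<exists>r\<in>T. a - r \<in> val_ge v (int N)"
    using finite_residues[OF p_nonzero v_p, of N] by blast
  define \<delta> where "\<delta> = emb (p ^ n) * \<Delta>"
  have \<delta>: "\<delta> \<in> R n"
    using mem_R_iff[of 0 "p ^ n" n] p_nonzero by (simp add: \<delta>_def mem_val_ge v_power v_p)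
  have "(\<lambda>y. (+) y ` ?I) ` R n \<subseteq> (\<lambda>(r, r'). (+) (emb r + emb r' * \<delta>) ` ?I) ` (T \<times> T)"
  proof
    fix Y assume "Y \<in> (\<lambda>y. (+) y ` ?I) ` R n"
    then obtain a b where Y: "Y = (+) (emb a + emb b * \<delta>) ` ?I"
      and ab: "a \<in> valuation_ring v" "b \<in> valuation_ring v"
      unfolding R_eq_span \<delta>_def by blast
    obtain r r' where r: "r \<in> T" "a - r \<in> val_ge v (int N)" "r' \<in> T" "b - r' \<in> val_ge v (int N)"
      using T(2) ab by blast
    define z where "z = emb (a - r) + emb (b - r') * \<delta>"
    have z: "z \<in> ?I"
      unfolding z_def using small[OF r(2) one_mem_R] small[OF r(4) \<delta>] by (simp add: I_add)
    have shift: "emb a + emb b * \<delta> = (emb r + emb r' * \<delta>) + z"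
      by (simp add: z_def emb_diff algebra_simps)
    have "(+) z ` ?I = ?I"
    proof (intro equalityI subsetI)
      fix y assume "y \<in> ?I"
      then have "- z + y \<in> ?I"
        using z by (intro I_add I_minus)
      then show "y \<in> (+) z ` ?I"
        by (rule rev_image_eqI) simp
    qed (use z I_add in blast)
    then have "Y = (+) (emb r + emb r' * \<delta>) ` ?I"
      unfolding Y shift by (metis (no_types, lifting) add.assoc image_cong image_image)
    with r show "Y \<in> (\<lambda>(r, r'). (+) (emb r + emb r' * \<delta>) ` ?I) ` (T \<times> T)"
      by (intro image_eqI[of _ _ "(r, r')"]) auto
  qed
  then show ?thesis
    by (rule finite_subset) (use T(1) in auto)
qed

lemma ideals_of_class_unit_R:
  assumes "\<alpha> dvd 1"
  shows "ideals_of_class emb (R n) (homothety_class emb ((*) \<alpha> ` R n)) =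
    {(*) (emb c * \<alpha>) ` R n |c. c \<noteq> 0 \<and> emb c * \<alpha> \<in> R n}"
proof (intro equalityI subsetI)
  have comp: "(*) (emb c) ` (*) \<alpha> ` R n = (*) (emb c * \<alpha>) ` R n" for c
    by (simp add: image_image mult.assoc)
  {
    fix I assume "I \<in> ideals_of_class emb (R n) (homothety_class emb ((*) \<alpha> ` R n))"
    then obtain \<gamma> where \<gamma>: "\<gamma> \<in> R n" "I = (*) \<gamma> ` R n"
      and "homothety_class emb I = homothety_class emb ((*) \<alpha> ` R n)"
      unfolding ideals_of_class_def finite_index_principal_ideals_def by blast
    then obtain c where c: "c \<noteq> 0" "I = (*) (emb c * \<alpha>) ` R n"
      using homothety_class_eqD comp by metis
    have "emb c * \<alpha> \<in> I"
      unfolding c(2) by (rule image_eqI[of _ _ 1]) (simp_all add: one_mem_R)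
    moreover have "I \<subseteq> R n"
      unfolding \<gamma>(2) using \<gamma>(1) by (auto intro: R_mult)
    ultimately show "I \<in> {(*) (emb c * \<alpha>) ` R n |c. c \<noteq> 0 \<and> emb c * \<alpha> \<in> R n}"
      using c by blast
  next
    fix I assume "I \<in> {(*) (emb c * \<alpha>) ` R n |c. c \<noteq> 0 \<and> emb c * \<alpha> \<in> R n}"
    then obtain c where c: "c \<noteq> 0" "emb c * \<alpha> \<in> R n" "I = (*) (emb c * \<alpha>) ` R n"
      by blast
    have "emb c * \<alpha> dvd 1"
      using emb_dvd_one[OF c(1)] assms by (metis mult_1 mult_dvd_mono)
    then show "I \<in> ideals_of_class emb (R n) (homothety_class emb ((*) \<alpha> ` R n))"
      unfolding ideals_of_class_def finite_index_principal_ideals_def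
      using c finite_index_unit_R[of "emb c * \<alpha>" n] homothety_class_scale[OF c(1), of "(*) \<alpha> ` R n"]
      by (auto simp: comp)
  }
qed

theorem types_of_shell:
  assumes "x \<in> basin_shell v p emb P n"
  shows "types_of emb val (R n) x = {source emb val (R n) x + of_nat k * e |k. True}"
proof -
  obtain \<alpha> where \<alpha>: "\<alpha> dvd 1" "x = homothety_class emb ((*) \<alpha> ` R n)"
    using assms by (rule shell_imp_class_unit_R)
  obtain m where m: "\<And>c. c \<noteq> 0 \<Longrightarrow> emb c * \<alpha> \<in> R n \<longleftrightarrow> m \<le> v c"
    using \<alpha>(1) by (rule emb_mult_mem_R_threshold) blast
  define I where "I c = (*) (emb c * \<alpha>) ` R n" for c
  define q where "q k = p powi k" for k
  have q: "q k \<noteq> 0" "v (q k) = k" for k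
    using p_nonzero by (simp_all add: q_def v_powi v_p)
  have ideals: "ideals_of_class emb (R n) x = {I c |c. c \<noteq> 0 \<and> m \<le> v c}"
    unfolding \<alpha>(2) ideals_of_class_unit_R[OF \<alpha>(1)] I_def using m by blast
  have type: "ideal_type val (R n) (I c) = of_int (v c) * e + val \<alpha>" if "c \<noteq> 0" for c
  proof -
    have "emb c * \<alpha> dvd 1"
      using emb_dvd_one[OF that] \<alpha>(1) by (metis mult_1 mult_dvd_mono)
    then show ?thesis
      unfolding I_def
      using emb_dvd_one[OF that] \<alpha>(1) by (simp add: ideal_type_unit_R val_mult val_emb[OF that])
  qed
  have type_diff: "ideal_type val (R n) (I c) - ideal_type val (R n) (I d) = of_int (v c - v d) * e"
    if "c \<noteq> 0" "d \<noteq> 0" for c d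
    using that by (simp add: type left_diff_distrib)
  have scale: "I c = (*) (emb (c / d)) ` I d" if "d \<noteq> 0" for c d
  proof -
    have "emb (c / d) * (emb d * y) = emb c * y" for y
      unfolding mult.assoc[symmetric] emb_mult[symmetric] using that by simp
    then show ?thesis
      unfolding I_def image_image mult.assoc by simp
  qed
  have I_cong: "I c = I d" if "c \<noteq> 0" "d \<noteq> 0" "v c = v d" for c d
  proof -
    have "c / d \<noteq> 0" "v (c / d) = 0"
      using that by (simp_all add: v_divide)
    then have "(*) (emb (c / d)) ` R n = R n"
      by (rule emb_unit_image_R)
    moreover have "I c = (*) (emb d * \<alpha>) ` (*) (emb (c / d)) ` R n"
      unfolding scale[OF that(2), of c] unfolding I_def
      by (simp only: image_image mult.assoc mult.left_commute)
    ultimately show ?thesis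
      by (simp add: I_def)
  qed
  have "source emb val (R n) x = ideal_type val (R n) (I (q m))"
    unfolding source_def
  proof (intro arg_cong[of _ _ "ideal_type val (R n)"] the_equality conjI ballI)
    show "I (q m) \<in> ideals_of_class emb (R n) x"
      unfolding ideals using q by (intro CollectI exI[of _ "q m"]) simp
    fix J assume "J \<in> ideals_of_class emb (R n) x"
    then obtain c where c: "J = I c" "c \<noteq> 0" "m \<le> v c"
      unfolding ideals by blast
    then have "0 \<le> ideal_type val (R n) J - ideal_type val (R n) (I (q m))"
      using type_diff[OF c(2) q(1)] q(2) e_order[of "v c - m"] by simp
    moreover have "c / q m \<noteq> 0"
      using c q by simp
    ultimately show "ideal_le emb val (R n) (I (q m)) J"
      unfolding ideal_le_def using c(1) scale[OF q(1)] by blast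
  next
    fix J assume J: "J \<in> ideals_of_class emb (R n) x \<and>
      (\<forall>J'\<in>ideals_of_class emb (R n) x. ideal_le emb val (R n) J J')"
    then obtain c where c: "J = I c" "c \<noteq> 0" "m \<le> v c"
      unfolding ideals by blast
    have "I (q m) \<in> ideals_of_class emb (R n) x"
      unfolding ideals using q by (intro CollectI exI[of _ "q m"]) simp
    then have "0 \<le> ideal_type val (R n) (I (q m)) - ideal_type val (R n) (I c)"
      using J c(1) unfolding ideal_le_def by blast
    then have "v c \<le> m"
      using type_diff[OF q(1) c(2)] q(2) e_order[of "m - v c"] by simp
    then show "J = I (q m)"
      unfolding c(1) using c q by (intro I_cong) auto
  qed
  then have src: "source emb val (R n) x = of_int m * e + val \<alpha>"
    using q by (simp add: type)
  show ?thesis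
    unfolding src types_of_def ideals
  proof (intro equalityI subsetI)
    fix z assume "z \<in> ideal_type val (R n) ` {I c |c. c \<noteq> 0 \<and> m \<le> v c}"
    then obtain c where c: "c \<noteq> 0" "m \<le> v c" "z = of_int (v c) * e + val \<alpha>"
      using type by blast
    have "of_int (v c) = (of_int m + of_nat (nat (v c - m)) :: 't)"
      using c(2) by (simp add: of_nat_nat)
    then have "z = of_int m * e + val \<alpha> + of_nat (nat (v c - m)) * e"
      unfolding c(3) by (simp add: algebra_simps)
    then show "z \<in> {of_int m * e + val \<alpha> + of_nat k * e |k. True}"
      by blast
  next
    fix z assume "z \<in> {of_int m * e + val \<alpha> + of_nat k * e |k. True}"
    then obtain k where "z = of_int m * e + val \<alpha> + of_nat k * e"
      by blast
    also have "\<dots> = of_int (v (q (m + int k))) * e + val \<alpha>"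
      by (simp add: q algebra_simps)
    also have "\<dots> = ideal_type val (R n) (I (q (m + int k)))"
      using q by (simp add: type)
    finally show "z \<in> ideal_type val (R n) ` {I c |c. c \<noteq> 0 \<and> m \<le> v c}"
      using q[of "m + int k"] by (intro image_eqI[of _ _ "I (q (m + int k))"]) auto
  qed
qed

end

lemma (in quadratic_extension) quadratic_order:
  assumes lf: "local_field v" and p: "p \<noteq> 0" "v p = 1" and e: "0 < e"
    and max_order: "valuation_ring w = adjoin v emb \<Delta>"
  obtains t s where
    "quadratic_order v emb p \<Delta> t s w e (range (\<lambda>k. homothety_class emb (val_ge w k)))"
proof -
  interpret v: local_field v by fact
  interpret ring_embedding emb
    by unfold_locales (fact emb_one emb_add emb_mult)+
  interpret V: vector_space "\<lambda>a x. emb a * x"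
    by unfold_locales (simp_all add: emb_add emb_mult algebra_simps)
  have emb_nz: "emb a \<noteq> 0" if "a \<noteq> 0" for a
    using emb_mult_inverse[OF that] by auto
  have emb_int: "emb a \<in> valuation_ring w \<longleftrightarrow> a \<in> valuation_ring v" for a
  proof (cases "a = 0")
    case False
    then show ?thesis
      using e emb_nz[of a] by (simp add: val_ge_def ramification_index zero_le_mult_iff)
  qed simp
  have scale: "\<exists>c. c \<noteq> 0 \<and> emb c * y \<in> valuation_ring w" for y
  proof (cases "y = 0")
    case False
    define N where "N = nat \<bar>w y\<bar>"
    have "w (emb (p ^ N) * y) = e * int N + w y"
      using False p emb_nz[of "p ^ N"] by (simp add: mult ramification_index v.v_power)
    moreover have "int N \<le> e * int N"
      using e by (simp add: mult_le_cancel_right1)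
    ultimately have "0 \<le> w (emb (p ^ N) * y)"
      unfolding N_def by linarith
    then show ?thesis
      using p by (intro exI[of _ "p ^ N"]) (auto simp: val_ge_def)
  qed (use p in \<open>auto intro!: exI[of _ 1]\<close>)
  have Delta_notin: "\<Delta> \<noteq> emb c" for c
  proof
    assume \<Delta>: "\<Delta> = emb c"
    have "poly (map_poly emb f) \<Delta> \<in> range emb" for f
    proof (induction f)
      case 0
      then show ?case
        by (auto intro: range_eqI[of _ _ 0])
    next
      case (pCons a f)
      then obtain b where "poly (map_poly emb f) \<Delta> = emb b"
        by blast
      then have "poly (map_poly emb (pCons a f)) \<Delta> = emb (a + c * b)"
        using pCons by (simp add: map_poly_pCons emb_add emb_mult \<Delta>)
      then show ?case
        by blast
    qed
    then have sub: "valuation_ring w \<subseteq> range emb"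
      unfolding max_order adjoin_def by blast
    have "y \<in> V.span {1}" for y
    proof -
      obtain c where c: "c \<noteq> 0" "emb c * y \<in> valuation_ring w"
        using scale by blast
      then obtain b where "emb c * y = emb b"
        using sub by blast
      then have "y = emb (inverse c) * emb b"
        using emb_mult_inverse[OF c(1)] by (metis mult.assoc mult.commute mult_1)
      then have "y = emb (inverse c * b) * 1"
        by (simp add: emb_mult)
      then show ?thesis
        by (metis V.span_base V.span_scale singletonI)
    qed
    then have "V.dim UNIV \<le> card {1 :: 'l}"
      by (intro V.dim_le_card) auto
    then show False
      using degree_two by simp
  qed
  have indep: "a = 0 \<and> b = 0" if ab: "emb a + emb b * \<Delta> = 0" for a b
  proof -
    have "b = 0"
    proof (rule ccontr)
      assume b: "b \<noteq> 0"
      have "emb b * \<Delta> = emb (- a)"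
        using ab by (simp add: emb_minus add_eq_0_iff2 add_eq_0_iff)
      then have "\<Delta> = emb (inverse b) * emb (- a)"
        using emb_mult_inverse[OF b] by (metis mult.assoc mult.commute mult_1)
      then show False
        using Delta_notin[of "inverse b * - a"] unfolding emb_mult by blast
    qed
    then show ?thesis
      using ab emb_nz by auto
  qed
  have "\<Delta> * \<Delta> \<in> V.span {1, \<Delta>}"
  proof (rule ccontr)
    assume not: "\<Delta> * \<Delta> \<notin> V.span {1, \<Delta>}"
    have span1: "V.span {1} = range emb"
      by (simp add: V.span_singleton)
    have ind1: "V.independent {\<Delta>, 1}"
      using Delta_notin span1 by (intro V.independent_insertI) (auto simp: V.dependent_single V.independent_empty)
    have ind: "V.independent {\<Delta> * \<Delta>, \<Delta>, 1}"
      using not by (intro V.independent_insertI[OF _ ind1]) (simp add: insert_commute)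
    obtain B where B: "V.independent B" "UNIV \<subseteq> V.span B" "card B = V.dim UNIV"
      using V.basis_exists[of UNIV] by metis
    have "finite B"
      using B(3) degree_two by (metis card.infinite zero_neq_numeral)
    then have "card {\<Delta> * \<Delta>, \<Delta>, 1} \<le> 2"
      using V.independent_span_bound[OF _ ind, of B] B degree_two by auto
    moreover have "\<Delta> * \<Delta> \<noteq> \<Delta>" "\<Delta> * \<Delta> \<noteq> 1" "\<Delta> \<noteq> 1"
      using not V.span_base[of _ "{1, \<Delta>}"] Delta_notin[of 1] by auto
    ultimately show False
      by simp
  qed
  then obtain s t where sq: "\<Delta> * \<Delta> = emb t * \<Delta> + emb s"
    unfolding V.span_insert V.span_singleton V.span_empty
    by (auto simp: algebra_simps)
  have Delta_int: "\<Delta> \<in> valuation_ring w"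
    unfolding max_order by (rule self_mem_adjoin[OF v.normalized_valuation_axioms])
  \<comment> \<open>Otherwise \<open>\<Delta>\<close> is a root of \<open>a X\<^sup>2 - X + b\<close> with \<open>a\<close> in the maximal ideal; this polynomial has
    a root in \<open>K\<close>, and its other root is not integral.\<close>
  have t_int: "t \<in> valuation_ring v"
  proof (rule ccontr)
    assume t: "t \<notin> valuation_ring v"
    then have t_nz: "t \<noteq> 0" and vt: "v t < 0"
      by (auto simp: val_ge_def)
    define a b where "a = inverse t" and "b = - s / t"
    have a: "a \<in> val_ge v 1" "a \<noteq> 0"
      using t_nz vt by (auto simp: a_def val_ge_def v.v_inverse)
    have "emb a * (\<Delta> * \<Delta>) + emb b = emb (a * t) * \<Delta> + emb (a * s + b)"
      unfolding sq by (simp add: emb_add emb_mult algebra_simps)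
    also have "\<dots> = \<Delta>"
      using t_nz by (simp add: a_def b_def field_simps)
    finally have eq: "\<Delta> = emb a * (\<Delta> * \<Delta>) + emb b"
      by simp
    have a_int: "emb a \<in> valuation_ring w"
      using a(1) by (simp add: emb_int v.val_ge_mono[of a 1 0])
    have "emb b = \<Delta> - emb a * (\<Delta> * \<Delta>)"
      using eq by (simp add: algebra_simps)
    also have "\<dots> \<in> valuation_ring w"
      by (intro val_ge_diff val_ge_mult0 a_int Delta_int)
    finally have "b \<in> valuation_ring v"
      by (simp add: emb_int)
    with a(1) obtain z where z: "z \<in> valuation_ring v" "z = a * z ^ 2 + b"
      by (rule v.quadratic_fixed_point)
    have "emb z = emb a * (emb z * emb z) + emb b"
      using z(2) by (metis emb_add emb_mult power2_eq_square)
    moreover have "(\<Delta> - emb z) * (1 - emb a * (\<Delta> + emb z)) =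
        (\<Delta> - (emb a * (\<Delta> * \<Delta>) + emb b)) - (emb z - (emb a * (emb z * emb z) + emb b))"
      by (simp add: algebra_simps)
    ultimately have "(\<Delta> - emb z) * (1 - emb a * (\<Delta> + emb z)) = 0"
      using eq by simp
    then have one: "emb a * (\<Delta> + emb z) = 1"
      using Delta_notin[of z] by simp
    then have "w (emb a) = 0"
      using a_int Delta_int z(1) by (intro v_unit[of _ "\<Delta> + emb z"] val_ge_add) (simp_all add: emb_int)
    then show False
      using a e by (auto simp: ramification_index val_ge_def)
  qed
  have s_int: "s \<in> valuation_ring v"
  proof -
    have "emb s = \<Delta> * \<Delta> - emb t * \<Delta>"
      using sq by simp
    also have "\<dots> \<in> valuation_ring w"
      using t_int by (intro val_ge_diff val_ge_mult0 Delta_int) (simp add: emb_int)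
    finally show ?thesis
      by (simp add: emb_int)
  qed
  note adjoin = adjoin_quadratic[OF v.normalized_valuation_axioms sq t_int s_int]
  have spans: "\<exists>a b. y = emb a + emb b * \<Delta>" for y
  proof -
    obtain c where c: "c \<noteq> 0" "emb c * y \<in> valuation_ring w"
      using scale by blast
    then obtain a b where "emb c * y = emb a + emb b * \<Delta>"
      unfolding max_order adjoin by blast
    then have "y = emb (inverse c) * (emb a + emb b * \<Delta>)"
      using emb_mult_inverse[OF c(1)] by (metis mult.assoc mult.commute mult_1)
    then have "y = emb (inverse c * a) + emb (inverse c * b) * \<Delta>"
      by (simp add: emb_mult algebra_simps)
    then show ?thesis
      by blast
  qed
  have primitive: "\<exists>\<alpha>\<in>\<Lambda>. \<exists>\<beta>. \<alpha> * \<beta> = 1 \<and> (*) \<beta> ` \<Lambda> \<subseteq> valuation_ring w"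
    if \<Lambda>: "is_lattice v emb \<Lambda>" for \<Lambda>
  proof -
    obtain z where z: "z \<in> \<Lambda>" "z \<noteq> 0" "\<And>y. y \<in> \<Lambda> \<Longrightarrow> y \<in> val_ge w (w z)"
      by (rule lattice_has_min[OF v.normalized_valuation_axioms normalized_valuation_axioms \<Lambda>,
            of "\<lambda>x. x"]) (auto simp: emb_int)
    have "inverse z * y \<in> valuation_ring w" if "y \<in> \<Lambda>" for y
      using val_ge_divide[OF z(3)[OF that] z(2)] by (simp add: divide_inverse mult.commute)
    then show ?thesis
      using z(1,2) by (intro bexI[of _ z] exI[of _ "inverse z"]) auto
  qed
  have basin: "range (\<lambda>k. homothety_class emb (val_ge w k)) =
    {homothety_class emb ((*) \<alpha> ` valuation_ring w) |\<alpha>. \<alpha> dvd 1}"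
  proof -
    obtain \<pi> where \<pi>: "\<pi> \<noteq> 0" "w \<pi> = 1"
      using normalized by blast
    have image: "(*) \<alpha> ` valuation_ring w = val_ge w (w \<alpha>)" if "\<alpha> dvd 1" for \<alpha>
      using that by (subst mult_image_val_ge) auto
    have "\<exists>\<alpha>. \<alpha> dvd 1 \<and> w \<alpha> = k" for k
      using \<pi> by (intro exI[of _ "\<pi> powi k"]) (simp add: v_powi dvd_field_iff)
    with image show ?thesis
      by (auto, metis)
  qed
  show thesis
  proof (rule that, unfold_locales)
    show "w (x * y) = w x + w y" if "x dvd 1" "y dvd 1" for x y
      using that by (intro mult) auto
    show "w (emb c) = of_int (v c) * e" if "c \<noteq> 0" for c
      using that by (simp add: ramification_index)
    show "w x = 0" if "x \<in> adjoin v emb \<Delta>" "y \<in> adjoin v emb \<Delta>" "x * y = 1" for x y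
      using that v_unit unfolding max_order[symmetric] by blast
    show "0 \<le> of_int k * e \<longleftrightarrow> 0 \<le> k" for k
      using e by (simp add: zero_le_mult_iff)
  qed (fact p sq t_int s_int indep spans primitive[unfolded max_order] basin[unfolded max_order])+
qed

lemma (in quadratic_extension) homothety_class_val_ge:
  assumes "p \<noteq> 0" "v p = 1" and lf: "local_field v"
  shows "homothety_class emb (val_ge w (k + e * j)) = homothety_class emb (val_ge w k)"
proof -
  interpret v: local_field v by fact
  interpret ring_embedding emb
    by unfold_locales (fact emb_one emb_add emb_mult)+
  have c: "p powi j \<noteq> 0" "v (p powi j) = j"
    using assms by (simp_all add: v.v_powi)
  have "emb (p powi j) \<noteq> 0"
    using emb_mult_inverse[OF c(1)] by auto
  then have "val_ge w (k + e * j) = (*) (emb (p powi j)) ` val_ge w k"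
    using c by (simp add: mult_image_val_ge ramification_index add.commute)
  then show ?thesis
    using homothety_class_scale[OF c(1)] by simp
qed

lemma of_int_prod: "(of_int k :: 'a::comm_ring_1 \<times> 'b::comm_ring_1) = (of_int k, of_int k)"
proof -
  have nat: "(of_nat n :: 'a \<times> 'b) = (of_nat n, of_nat n)" for n
    by (induction n) (simp_all add: zero_prod_def one_prod_def)
  show ?thesis
    by (cases k rule: int_cases2) (simp_all add: nat)
qed

lemma split_unit_iff: "\<alpha> dvd 1 \<longleftrightarrow> fst \<alpha> \<noteq> 0 \<and> snd \<alpha> \<noteq> 0" for \<alpha> :: "'a::field \<times> 'b::field"
proof
  assume "\<alpha> dvd 1"
  then obtain \<beta> where "1 = \<alpha> * \<beta>"
    by (rule dvdE)
  then show "fst \<alpha> \<noteq> 0 \<and> snd \<alpha> \<noteq> 0"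
    by (auto simp: one_prod_def times_prod_def)
next
  assume "fst \<alpha> \<noteq> 0 \<and> snd \<alpha> \<noteq> 0"
  then have "1 = \<alpha> * (inverse (fst \<alpha>), inverse (snd \<alpha>))"
    by (simp add: one_prod_def times_prod_def)
  then show "\<alpha> dvd 1"
    by (rule dvdI)
qed

lemma (in local_field) split_quadratic_order:
  assumes p: "p \<noteq> 0" "v p = 1"
    and max_order: "valuation_ring v \<times> valuation_ring v = adjoin v diag \<Delta>"
  obtains t s where "quadratic_order v diag p \<Delta> t s (split_val v) (1, 1) (split_basin v p)"
proof -
  interpret ring_embedding "diag :: 'a \<Rightarrow> 'a \<times> 'a"
    by unfold_locales (simp_all add: diag_def one_prod_def times_prod_def)
  obtain d d' where \<Delta>: "\<Delta> = (d, d')"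
    by (cases \<Delta>)
  have "\<Delta> \<in> adjoin v diag \<Delta>"
    by (rule self_mem_adjoin[OF normalized_valuation_axioms])
  then have d: "d \<in> valuation_ring v" "d' \<in> valuation_ring v"
    unfolding max_order[symmetric] by (auto simp: \<Delta>)
  define t s where "t = d + d'" and "s = - (d * d')"
  have sq: "\<Delta> * \<Delta> = diag t * \<Delta> + diag s"
    by (simp add: \<Delta> t_def s_def diag_def times_prod_def algebra_simps)
  have ts: "t \<in> valuation_ring v" "s \<in> valuation_ring v"
    using d by (auto simp: t_def s_def intro: val_ge_add val_ge_minus val_ge_mult0)
  note adjoin = adjoin_quadratic[OF normalized_valuation_axioms sq ts]
  have comb: "diag a + diag b * \<Delta> = (a + b * d, a + b * d')" for a b
    by (simp add: \<Delta> diag_def times_prod_def)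
  have "(1, 0) \<in> adjoin v diag \<Delta>"
    unfolding max_order[symmetric] by simp
  then have ne: "d \<noteq> d'"
    unfolding adjoin comb by auto
  have primitive: "\<exists>\<alpha>\<in>\<Lambda>. \<exists>\<beta>. \<alpha> * \<beta> = 1 \<and> (*) \<beta> ` \<Lambda> \<subseteq> valuation_ring v \<times> valuation_ring v"
    if \<Lambda>: "is_lattice v diag \<Lambda>" for \<Lambda>
  proof -
    note min = lattice_has_min[OF normalized_valuation_axioms normalized_valuation_axioms \<Lambda>]
    obtain x where x: "x \<in> \<Lambda>" "fst x \<noteq> 0" "\<And>y. y \<in> \<Lambda> \<Longrightarrow> fst y \<in> val_ge v (v (fst x))"
      by (rule min[of fst]) (auto simp: one_prod_def times_prod_def diag_def)
    obtain y where y: "y \<in> \<Lambda>" "snd y \<noteq> 0" "\<And>z. z \<in> \<Lambda> \<Longrightarrow> snd z \<in> val_ge v (v (snd y))"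
      by (rule min[of snd]) (auto simp: one_prod_def times_prod_def diag_def)
    \<comment> \<open>one of \<open>x\<close>, \<open>y\<close>, \<open>x + y\<close> is minimal in both coordinates\<close>
    obtain \<alpha> where \<alpha>: "\<alpha> \<in> \<Lambda>" "fst \<alpha> \<noteq> 0" "snd \<alpha> \<noteq> 0"
      "v (fst \<alpha>) = v (fst x)" "v (snd \<alpha>) = v (snd y)"
    proof -
      have xy: "snd x = 0 \<or> v (snd y) \<le> v (snd x)" "fst y = 0 \<or> v (fst x) \<le> v (fst y)"
        using x y by (auto simp: val_ge_def)
      consider "snd x \<noteq> 0" "v (snd x) = v (snd y)" | "fst y \<noteq> 0" "v (fst y) = v (fst x)"
        | "snd x \<in> val_ge v (v (snd y) + 1)" "fst y \<in> val_ge v (v (fst x) + 1)"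
        using xy by (fastforce simp: val_ge_def)
      then show thesis
      proof cases
        case 3
        have strict: "a + b \<noteq> 0 \<and> v (a + b) \<le> v a" if "a \<noteq> 0" "b \<in> val_ge v (v a + 1)" for a b
        proof -
          have "a + b \<notin> val_ge v (v a + 1)"
          proof
            assume "a + b \<in> val_ge v (v a + 1)"
            from val_ge_diff[OF this that(2)] show False
              using that(1) by (simp add: mem_val_ge)
          qed
          then show ?thesis
            by (auto simp: val_ge_def)
        qed
        have "x + y \<in> \<Lambda>"
          using x(1) y(1) by (rule lattice_add[OF normalized_valuation_axioms \<Lambda>])
        moreover have "fst (x + y) \<noteq> 0 \<and> v (fst (x + y)) \<le> v (fst x)"
          using strict[OF x(2) 3(2)] by simp
        moreover have "snd (x + y) \<noteq> 0 \<and> v (snd (x + y)) \<le> v (snd y)"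
          using strict[OF y(2) 3(1)] by (simp add: add.commute)
        ultimately show thesis
          using x(3)[of "x + y"] y(3)[of "x + y"] by (intro that[of "x + y"]) (auto simp: val_ge_def)
      qed (use x y that in auto)
    qed
    define \<beta> where "\<beta> = (inverse (fst \<alpha>), inverse (snd \<alpha>))"
    have "\<alpha> * \<beta> = 1"
      using \<alpha> by (simp add: \<beta>_def times_prod_def one_prod_def)
    moreover have "\<beta> * z \<in> valuation_ring v \<times> valuation_ring v" if "z \<in> \<Lambda>" for z
      using val_ge_divide[OF x(3)[OF that] \<alpha>(2)] val_ge_divide[OF y(3)[OF that] \<alpha>(3)] \<alpha>(4,5)
      by (simp add: \<beta>_def times_prod_def divide_inverse mult.commute mem_Times_iff)
    ultimately show ?thesis
      using \<alpha>(1) by blast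
  qed
  have image: "(*) (a, b) ` (A \<times> B) = (*) a ` A \<times> (*) b ` B" for a b :: 'a and A B
    by (force simp: times_prod_def)
  have basin: "split_basin v p =
    {homothety_class diag ((*) \<alpha> ` (valuation_ring v \<times> valuation_ring v)) |\<alpha>. \<alpha> dvd 1}"
  proof (intro equalityI subsetI)
    fix x assume "x \<in> split_basin v p"
    then obtain m where
      "x = homothety_class diag (valuation_ring v \<times> (*) (p powi m) ` valuation_ring v)"
      unfolding split_basin_def by blast
    then have "x = homothety_class diag ((*) (1, p powi m) ` (valuation_ring v \<times> valuation_ring v))"
      by (simp add: image)
    moreover have "(1 :: 'a, p powi m) dvd 1"
      using p by (simp add: split_unit_iff)
    ultimately show
      "x \<in> {homothety_class diag ((*) \<alpha> ` (valuation_ring v \<times> valuation_ring v)) |\<alpha>. \<alpha> dvd 1}"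
      by blast
  next
    fix x assume
      "x \<in> {homothety_class diag ((*) \<alpha> ` (valuation_ring v \<times> valuation_ring v)) |\<alpha>. \<alpha> dvd 1}"
    then obtain a b where ab: "a \<noteq> 0" "b \<noteq> 0"
      and x: "x = homothety_class diag ((*) (a, b) ` (valuation_ring v \<times> valuation_ring v))"
      by (auto simp: split_unit_iff)
    define m where "m = v b - v a"
    have "(*) (a, b) ` (valuation_ring v \<times> valuation_ring v) =
      (*) (diag a) ` (valuation_ring v \<times> (*) (p powi m) ` valuation_ring v)"
      unfolding diag_def image using ab p by (simp add: mult_image_val_ge v_powi m_def)
    then have "x = homothety_class diag (valuation_ring v \<times> (*) (p powi m) ` valuation_ring v)"
      using x homothety_class_scale[OF ab(1)] by simp
    then show "x \<in> split_basin v p"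
      unfolding split_basin_def by blast
  qed
  show thesis
  proof (rule that, unfold_locales)
    show "a = 0 \<and> b = 0" if "diag a + diag b * \<Delta> = 0" for a b
    proof -
      have eqs: "a + b * d = 0" "a + b * d' = 0"
        using that unfolding comb by (simp_all add: zero_prod_def)
      have "b * (d - d') = (a + b * d) - (a + b * d')"
        by (simp add: algebra_simps)
      then have "b * (d - d') = 0"
        using eqs by simp
      with ne eqs show ?thesis
        by simp
    qed
    show "\<exists>a b. y = diag a + diag b * \<Delta>" for y
    proof -
      define b where "b = (fst y - snd y) / (d - d')"
      have "b * (d - d') = fst y - snd y"
        using ne by (simp add: b_def)
      then have "y = diag (fst y - b * d) + diag b * \<Delta>"
        unfolding comb by (simp add: prod_eq_iff algebra_simps)
      then show ?thesis
        by blast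
    qed
    show "split_val v (x * y) = split_val v x + split_val v y" if "x dvd 1" "y dvd 1" for x y
      using that by (simp add: split_val_def times_prod_def split_unit_iff mult)
    show "split_val v (diag c) = of_int (v c) * (1, 1)" if "c \<noteq> 0" for c
      by (simp add: split_val_def diag_def of_int_prod times_prod_def)
    show "split_val v x = 0"
      if "x \<in> adjoin v diag \<Delta>" "y \<in> adjoin v diag \<Delta>" "x * y = 1" for x y
      using that v_unit[of "fst x" "fst y"] v_unit[of "snd x" "snd y"]
      unfolding max_order[symmetric]
      by (auto simp: split_val_def zero_prod_def times_prod_def one_prod_def)
    show "0 \<le> of_int k * (1 :: int, 1 :: int) \<longleftrightarrow> 0 \<le> k" for k
      by (simp add: of_int_prod times_prod_def zero_prod_def less_eq_prod_def)
  qed (fact p sq ts primitive[unfolded max_order] basin[unfolded max_order])+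
qed

theorem theorem6p9:
  fixes v :: "'k::field_char_0 \<Rightarrow> int" and p :: 'k and n :: nat
  assumes "local_field v" and "p \<noteq> 0" and "v p = 1"
  shows
    "(\<forall>(emb :: 'k \<Rightarrow> 'l::field) w \<Delta> x.
        unramified_quadratic v emb w \<and> valuation_ring w = adjoin v emb \<Delta> \<and>
        x \<in> basin_shell v p emb (unramified_basin emb w) n \<longrightarrow>
        types_of emb w (order_ring v p emb \<Delta> n) x =
          {source emb w (order_ring v p emb \<Delta> n) x + of_nat k * 1 |k. True}) \<and>
     (\<forall>(emb :: 'k \<Rightarrow> 'l) w \<pi> \<Delta> x.
        ramified_quadratic v emb w \<and> \<pi> \<noteq> 0 \<and> w \<pi> = 1 \<and> valuation_ring w = adjoin v emb \<Delta> \<and>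
        x \<in> basin_shell v p emb (ramified_basin emb w \<pi>) n \<longrightarrow>
        types_of emb w (order_ring v p emb \<Delta> n) x =
          {source emb w (order_ring v p emb \<Delta> n) x + of_nat k * 2 |k. True}) \<and>
     (\<forall>(\<Delta> :: 'k \<times> 'k) x.
        valuation_ring v \<times> valuation_ring v = adjoin v diag \<Delta> \<and>
        x \<in> basin_shell v p diag (split_basin v p) n \<longrightarrow>
        types_of diag (split_val v) (order_ring v p diag \<Delta> n) x =
          {source diag (split_val v) (order_ring v p diag \<Delta> n) x + of_nat k * (1, 1) |k. True})"
proof (intro conjI allI impI; elim conjE)
  fix emb :: "'k \<Rightarrow> 'l" and w \<Delta> x
  assume ext: "unramified_quadratic v emb w" and max_order: "valuation_ring w = adjoin v emb \<Delta>"
    and x: "x \<in> basin_shell v p emb (unramified_basin emb w) n"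
  interpret quadratic_extension w v emb 1
    using ext by (simp add: unramified_quadratic_def)
  obtain t s where
    "quadratic_order v emb p \<Delta> t s w 1 (range (\<lambda>k. homothety_class emb (val_ge w k)))"
    using quadratic_order[OF assms _ max_order] by auto
  moreover have "range (\<lambda>k. homothety_class emb (val_ge w k)) = unramified_basin emb w"
    unfolding unramified_basin_def
    using homothety_class_val_ge[OF assms(2,3,1), of 0] by auto
  ultimately show "types_of emb w (order_ring v p emb \<Delta> n) x =
      {source emb w (order_ring v p emb \<Delta> n) x + of_nat k * 1 |k. True}"
    using x by (metis quadratic_order.types_of_shell)
next
  fix emb :: "'k \<Rightarrow> 'l" and w \<pi> \<Delta> x
  assume ext: "ramified_quadratic v emb w" and max_order: "valuation_ring w = adjoin v emb \<Delta>"
    and \<pi>: "\<pi> \<noteq> 0" "w \<pi> = 1"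
    and x: "x \<in> basin_shell v p emb (ramified_basin emb w \<pi>) n"
  interpret quadratic_extension w v emb 2
    using ext by (simp add: ramified_quadratic_def)
  obtain t s where
    "quadratic_order v emb p \<Delta> t s w 2 (range (\<lambda>k. homothety_class emb (val_ge w k)))"
    using quadratic_order[OF assms _ max_order] by auto
  moreover have "range (\<lambda>k. homothety_class emb (val_ge w k)) = ramified_basin emb w \<pi>"
  proof -
    have "homothety_class emb (val_ge w k) = homothety_class emb (val_ge w (k mod 2))" for k
      using homothety_class_val_ge[OF assms(2,3,1), of "k mod 2" "k div 2"] by simp
    moreover have "k mod 2 = 0 \<or> k mod 2 = 1" for k :: int
      by presburger
    ultimately have "homothety_class emb (val_ge w k)
        \<in> {homothety_class emb (val_ge w 0), homothety_class emb (val_ge w 1)}" for k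
      by (metis insertI1 insertI2)
    then show ?thesis
      unfolding ramified_basin_def using \<pi> by (auto simp: mult_image_val_ge)
  qed
  ultimately show "types_of emb w (order_ring v p emb \<Delta> n) x =
      {source emb w (order_ring v p emb \<Delta> n) x + of_nat k * 2 |k. True}"
    using x by (metis quadratic_order.types_of_shell)
next
  fix \<Delta> :: "'k \<times> 'k" and x
  assume max_order: "valuation_ring v \<times> valuation_ring v = adjoin v diag \<Delta>"
    and x: "x \<in> basin_shell v p diag (split_basin v p) n"
  obtain t s where "quadratic_order v diag p \<Delta> t s (split_val v) (1, 1) (split_basin v p)"
    using local_field.split_quadratic_order[OF assms max_order] .
  then show "types_of diag (split_val v) (order_ring v p diag \<Delta> n) x =
      {source diag (split_val v) (order_ring v p diag \<Delta> n) x + of_nat k * (1, 1) |k. True}"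
    using x by (rule quadratic_order.types_of_shell)
qed

end
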